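(* Let $\mathbb{F}$ be a field. Let $K$ be a simplicial complex whose vertices are partitioned into $m+1$ subsets $V_0,\ldots,V_m$ and such that $\widetilde{H}_{m-1}(K,\mathbb{F})=0$. Let $k$ be an integer such that $-1\le k\le m-1$. Suppose that for every $S\subseteq\{0,\ldots,m\}$: (1) $\widetilde{H}_{k-|S|}\big(K_{\{0,\ldots,m\}\setminus S},\mathbb{F}\big)=0$ whenever $1\le|S|\le k+1$; (2) $\widetilde{H}_{|S|-2}\big(\tilde K_S,\mathbb{F}\big)=0$ whenever $k+2\le|S|\le m$. Then $K$ contains a rainbow simplex.
   Context: Simplicial complexes are abstract and the empty set is not a simplex, so the minimal dimension of a simplex is $0$. $\widetilde{H}$ denotes reduced simplicial homology; $\widetilde{H}_{-1}(Y,\mathbb{F})=0$ if and only if $Y$ is nonempty. The sets $V_0,\ldots,V_m$ are viewed as colours: a vertex in $V_i$ has colour $i$. For $S\subseteq\{0,\ldots,m\}$, $K_S$ is the subcomplex of $K$ induced by the vertices in $\bigcup_{i\in S}V_i$ (all simplices of $K$ whose vertices all lie in $\bigcup_{i\in S}V_i$), and $\tilde K_S$ is the subcomplex of $K$ consisting of those simplices $\sigma$ of $K$ such that the set of colours of the vertices of $\sigma$ does not contain $S$. A rainbow simplex is a simplex of $K$ that has exactly one vertex in each $V_i$, $i=0,\ldots,m$. *)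

theory Defs
  imports "HOL-Library.Poly_Mapping" "HOL-Library.Disjoint_Sets" "HOL-Algebra.Elementary_Groups"
begin

section \<open>Simplicial complexes\<close>

definition simplicial_complex :: "'v set set \<Rightarrow> bool" where
  "simplicial_complex K \<longleftrightarrow>
     (\<forall>\<sigma>\<in>K. finite \<sigma> \<and> \<sigma> \<noteq> {} \<and> (\<forall>\<tau>. \<tau> \<subseteq> \<sigma> \<and> \<tau> \<noteq> {} \<longrightarrow> \<tau> \<in> K))"

definition vertices :: "'v set set \<Rightarrow> 'v set" where
  "vertices K = \<Union>K"

section \<open>Reduced simplicial homology\<close>

text \<open>Simplices are oriented by one total order on the vertex type, fixed once and for all.
  In the augmented chain complex the empty set spans the chains of degree $-1$.\<close>

definition vertex_order :: "'v rel" where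
  "vertex_order = (SOME r. linear_order_on UNIV r)"

text \<open>The empty set is adjoined only here; for \<open>d < -1\<close> there are no faces.\<close>

definition faces :: "int \<Rightarrow> 'v set set \<Rightarrow> 'v set set" where
  "faces d K = {\<sigma> \<in> insert {} K. finite \<sigma> \<and> int (card \<sigma>) = d + 1}"

definition simplicial_chains :: "int \<Rightarrow> 'v set set \<Rightarrow> ('v set \<Rightarrow>\<^sub>0 'f::field) set" where
  "simplicial_chains d K = {c. Poly_Mapping.keys c \<subseteq> faces d K}"

definition position :: "'v \<Rightarrow> 'v set \<Rightarrow> nat" where
  "position v \<sigma> = card {u \<in> \<sigma>. u \<noteq> v \<and> (u, v) \<in> vertex_order}"

text \<open>The boundary of \<open>a\<close> times the simplex with vertices $v_0 < \dots < v_d$ is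
  $\sum_i (-1)^i a\,[v_0,\dots,\widehat{v_i},\dots,v_d]$, extended additively to chains.\<close>

definition simplex_boundary :: "'v set \<Rightarrow> 'f \<Rightarrow> ('v set \<Rightarrow>\<^sub>0 'f::field)" where
  "simplex_boundary \<sigma> a = (\<Sum>v\<in>\<sigma>. Poly_Mapping.single (\<sigma> - {v}) ((-1) ^ position v \<sigma> * a))"

definition boundary :: "('v set \<Rightarrow>\<^sub>0 'f) \<Rightarrow> ('v set \<Rightarrow>\<^sub>0 'f::field)" where
  "boundary c = (\<Sum>\<sigma>\<in>Poly_Mapping.keys c. simplex_boundary \<sigma> (Poly_Mapping.lookup c \<sigma>))"

definition cycles :: "int \<Rightarrow> 'v set set \<Rightarrow> ('v set \<Rightarrow>\<^sub>0 'f::field) set" where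
  "cycles d K = {c \<in> simplicial_chains d K. boundary c = 0}"

definition boundaries :: "int \<Rightarrow> 'v set set \<Rightarrow> ('v set \<Rightarrow>\<^sub>0 'f::field) set" where
  "boundaries d K = boundary ` simplicial_chains (d + 1) K"

definition cycle_group :: "'f::field itself \<Rightarrow> int \<Rightarrow> 'v set set \<Rightarrow> ('v set \<Rightarrow>\<^sub>0 'f) monoid" where
  "cycle_group F d K = \<lparr>carrier = cycles d K, monoid.mult = (+), one = 0\<rparr>"

text \<open>Only the additive group underlying the vector space is recorded, which is enough to
  say that the homology vanishes.\<close>

definition reduced_homology ::
    "'f::field itself \<Rightarrow> int \<Rightarrow> 'v set set \<Rightarrow> ('v set \<Rightarrow>\<^sub>0 'f) set monoid" where
  "reduced_homology F d K = cycle_group F d K Mod boundaries d K"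

section \<open>Coloured complexes\<close>

definition colours :: "(nat \<Rightarrow> 'v set) \<Rightarrow> 'v set \<Rightarrow> nat set" where
  "colours V \<sigma> = {i. \<sigma> \<inter> V i \<noteq> {}}"

definition colour_induced :: "(nat \<Rightarrow> 'v set) \<Rightarrow> 'v set set \<Rightarrow> nat set \<Rightarrow> 'v set set" where
  "colour_induced V K S = {\<sigma> \<in> K. \<sigma> \<subseteq> (\<Union>i\<in>S. V i)}"

definition colour_missing :: "(nat \<Rightarrow> 'v set) \<Rightarrow> 'v set set \<Rightarrow> nat set \<Rightarrow> 'v set set" where
  "colour_missing V K S = {\<sigma> \<in> K. \<not> S \<subseteq> colours V \<sigma>}"

definition rainbow_simplex :: "nat \<Rightarrow> (nat \<Rightarrow> 'v set) \<Rightarrow> 'v set set \<Rightarrow> 'v set \<Rightarrow> bool" where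
  "rainbow_simplex m V K \<sigma> \<longleftrightarrow> \<sigma> \<in> K \<and> (\<forall>i\<in>{0..m}. \<exists>!v. v \<in> \<sigma> \<inter> V i)"

section \<open>Basic facts about the chain complex\<close>

lemma linear_vertex_order: "linear_order_on UNIV (vertex_order :: 'v rel)"
proof -
  obtain r :: "'v rel" where "well_order_on UNIV r"
    using well_order_on by blast
  then have "linear_order_on UNIV r"
    by (simp add: well_order_on_def)
  then show ?thesis
    unfolding vertex_order_def by (rule someI)
qed

lemma simplex_boundary_zero [simp]: "simplex_boundary \<sigma> 0 = 0"
  by (simp add: simplex_boundary_def)

lemma simplex_boundary_add:
  "simplex_boundary \<sigma> (a + b) = simplex_boundary \<sigma> a + simplex_boundary \<sigma> b"
  by (simp add: simplex_boundary_def distrib_left single_add sum.distrib)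

lemma boundary_superset:
  assumes "finite A" "Poly_Mapping.keys c \<subseteq> A"
  shows "boundary c = (\<Sum>\<sigma>\<in>A. simplex_boundary \<sigma> (Poly_Mapping.lookup c \<sigma>))"
  unfolding boundary_def using assms
  by (intro sum.mono_neutral_left) (auto simp: in_keys_iff)

lemma boundary_zero [simp]: "boundary 0 = 0"
  by (simp add: boundary_def)

lemma boundary_add: "boundary (c + d) = boundary c + boundary d"
proof -
  let ?A = "Poly_Mapping.keys c \<union> Poly_Mapping.keys d"
  have "Poly_Mapping.keys (c + d) \<subseteq> ?A"
    by (rule keys_add)
  then show ?thesis
    by (simp add: boundary_superset[of ?A] lookup_add simplex_boundary_add sum.distrib)
qed

lemma boundary_uminus: "boundary (- c) = - boundary c"
  using boundary_add[of c "- c"] by (simp add: eq_neg_iff_add_eq_0 add.commute)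

lemma boundary_sum: "boundary (sum f A) = (\<Sum>x\<in>A. boundary (f x))"
  by (induction A rule: infinite_finite_induct) (simp_all add: boundary_add)

lemma boundary_single: "boundary (Poly_Mapping.single \<sigma> a) = simplex_boundary \<sigma> a"
  by (simp add: boundary_superset[of "{\<sigma>}"])

lemma chains_zero [simp]: "0 \<in> simplicial_chains d K"
  by (simp add: simplicial_chains_def)

lemma chains_add:
  "c \<in> simplicial_chains d K \<Longrightarrow> c' \<in> simplicial_chains d K \<Longrightarrow> c + c' \<in> simplicial_chains d K"
  using keys_add[of c c'] by (auto simp: simplicial_chains_def)

lemma chains_uminus: "c \<in> simplicial_chains d K \<Longrightarrow> - c \<in> simplicial_chains d K"
  by (auto simp: simplicial_chains_def in_keys_iff)

lemma chains_sum:
  "(\<And>x. x \<in> A \<Longrightarrow> f x \<in> simplicial_chains d K) \<Longrightarrow> sum f A \<in> simplicial_chains d K"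
  by (induction A rule: infinite_finite_induct) (simp_all add: chains_add)

lemma faces_remove:
  assumes "simplicial_complex K" "\<sigma> \<in> faces (d + 1) K" "v \<in> \<sigma>"
  shows "\<sigma> - {v} \<in> faces d K"
proof -
  have "\<sigma> \<in> K" "finite \<sigma>" "int (card \<sigma>) = d + 2"
    using assms(2,3) by (auto simp: faces_def)
  moreover have "card \<sigma> = Suc (card (\<sigma> - {v}))"
    by (rule card_Suc_Diff1[OF \<open>finite \<sigma>\<close> assms(3), symmetric])
  moreover have "\<sigma> - {v} \<in> insert {} K"
  proof (cases "\<sigma> - {v} = {}")
    case False
    then show ?thesis
      using assms(1) \<open>\<sigma> \<in> K\<close> unfolding simplicial_complex_def by (meson Diff_subset insertI2)
  qed simp
  moreover have "finite (\<sigma> - {v})"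
    using \<open>finite \<sigma>\<close> by simp
  moreover have "int (card (\<sigma> - {v})) = d + 1"
    using calculation by linarith
  ultimately show ?thesis
    unfolding faces_def by blast
qed

lemma boundary_in_chains:
  assumes "simplicial_complex K" "c \<in> simplicial_chains (d + 1) K"
  shows "boundary c \<in> simplicial_chains d K"
  unfolding boundary_def simplex_boundary_def
proof (intro chains_sum)
  fix \<sigma> v
  assume "\<sigma> \<in> Poly_Mapping.keys c" "v \<in> \<sigma>"
  then have "\<sigma> - {v} \<in> faces d K"
    using assms faces_remove[OF assms(1), of \<sigma> d v] by (auto simp: simplicial_chains_def)
  then show "Poly_Mapping.single (\<sigma> - {v}) ((-1) ^ position v \<sigma> * Poly_Mapping.lookup c \<sigma>)
      \<in> simplicial_chains d K"
    by (auto simp: simplicial_chains_def)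
qed

lemma position_remove:
  assumes "finite \<sigma>" "v \<in> \<sigma>" "w \<in> \<sigma>" "v \<noteq> w" "(v, w) \<in> vertex_order"
  shows "position w \<sigma> = Suc (position w (\<sigma> - {v}))" "position v (\<sigma> - {w}) = position v \<sigma>"
proof -
  have "{u \<in> \<sigma>. u \<noteq> w \<and> (u, w) \<in> vertex_order} =
      insert v {u \<in> \<sigma> - {v}. u \<noteq> w \<and> (u, w) \<in> vertex_order}"
    using assms by auto
  then show "position w \<sigma> = Suc (position w (\<sigma> - {v}))"
    using assms(1) by (simp add: position_def)
  have "(w, v) \<notin> vertex_order"
    using linear_vertex_order assms(4,5)
    by (auto simp: linear_order_on_def partial_order_on_def antisym_def)
  then have "{u \<in> \<sigma> - {w}. u \<noteq> v \<and> (u, v) \<in> vertex_order} =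
      {u \<in> \<sigma>. u \<noteq> v \<and> (u, v) \<in> vertex_order}"
    by auto
  then show "position v (\<sigma> - {w}) = position v \<sigma>"
    by (simp add: position_def)
qed

lemma boundary_simplex_boundary:
  fixes a :: "'f::field"
  assumes fin: "finite (\<sigma> :: 'v set)"
  shows "boundary (simplex_boundary \<sigma> a) = 0"
proof -
  define g :: "'v \<Rightarrow> 'v \<Rightarrow> ('v set \<Rightarrow>\<^sub>0 'f)" where
    "g v w = Poly_Mapping.single (\<sigma> - {v} - {w})
      ((-1) ^ position w (\<sigma> - {v}) * ((-1) ^ position v \<sigma> * a))" for v w
  define P where "P = {(v, w). v \<in> \<sigma> \<and> w \<in> \<sigma> \<and> v \<noteq> w \<and> (v, w) \<in> vertex_order}"
  define Q where "Q = {(w, v). v \<in> \<sigma> \<and> w \<in> \<sigma> \<and> v \<noteq> w \<and> (v, w) \<in> vertex_order}"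
  have "P \<subseteq> \<sigma> \<times> \<sigma>" "Q \<subseteq> \<sigma> \<times> \<sigma>"
    by (auto simp: P_def Q_def)
  then have finPQ: "finite P" "finite Q"
    using fin by (meson finite_SigmaI finite_subset)+
  have lin: "antisym (vertex_order :: 'v rel)" "total_on UNIV (vertex_order :: 'v rel)"
    using linear_vertex_order by (auto simp: linear_order_on_def partial_order_on_def)
  have disj: "P \<inter> Q = {}"
    using lin(1) by (auto simp: P_def Q_def antisym_def)
  have un: "Sigma \<sigma> (\<lambda>v. \<sigma> - {v}) = P \<union> Q"
    using lin(2) by (auto simp: P_def Q_def total_on_def)
  have neg: "g v w + g w v = 0" if "(v, w) \<in> P" for v w
  proof -
    have "position w \<sigma> = Suc (position w (\<sigma> - {v}))" "position v (\<sigma> - {w}) = position v \<sigma>"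
      using that fin position_remove[of \<sigma> v w] by (auto simp: P_def)
    moreover have "\<sigma> - {w} - {v} = \<sigma> - {v} - {w}"
      by auto
    ultimately show ?thesis
      by (simp add: g_def flip: single_add)
  qed
  have "boundary (simplex_boundary \<sigma> a) = (\<Sum>v\<in>\<sigma>. \<Sum>w\<in>\<sigma> - {v}. g v w)"
    unfolding simplex_boundary_def[of \<sigma>] boundary_sum boundary_single
    by (simp add: simplex_boundary_def g_def)
  also have "\<dots> = (\<Sum>(v, w)\<in>Sigma \<sigma> (\<lambda>v. \<sigma> - {v}). g v w)"
    using fin by (simp add: sum.Sigma)
  also have "\<dots> = (\<Sum>(v, w)\<in>P. g v w) + (\<Sum>(v, w)\<in>Q. g v w)"
    unfolding un using finPQ disj by (simp add: sum.union_disjoint)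
  also have "(\<Sum>(v, w)\<in>Q. g v w) = (\<Sum>(v, w)\<in>P. g w v)"
    by (rule sum.reindex_bij_witness[of _ "\<lambda>(v, w). (w, v)" "\<lambda>(v, w). (w, v)"])
      (auto simp: P_def Q_def)
  also have "(\<Sum>(v, w)\<in>P. g v w) + (\<Sum>(v, w)\<in>P. g w v) = (\<Sum>(v, w)\<in>P. g v w + g w v)"
    by (simp add: sum.distrib case_prod_unfold)
  also have "\<dots> = 0"
    using neg by (intro sum.neutral) auto
  finally show ?thesis .
qed

lemma boundary_boundary:
  assumes "c \<in> simplicial_chains d K"
  shows "boundary (boundary c) = 0"
  unfolding boundary_def[of c] boundary_sum
  using assms
  by (intro sum.neutral ballI boundary_simplex_boundary) (auto simp: simplicial_chains_def faces_def)

lemma boundaries_subset_cycles: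
  assumes "simplicial_complex K"
  shows "boundaries d K \<subseteq> cycles d K"
  using assms by (auto simp: boundaries_def cycles_def boundary_in_chains boundary_boundary)

lemma comm_group_cycle_group: "comm_group (cycle_group F d K)"
proof (rule comm_groupI)
  fix x
  assume "x \<in> carrier (cycle_group F d K)"
  then show "\<exists>y\<in>carrier (cycle_group F d K). y \<otimes>\<^bsub>cycle_group F d K\<^esub> x = \<one>\<^bsub>cycle_group F d K\<^esub>"
    by (intro bexI[of _ "- x"])
      (auto simp: cycle_group_def cycles_def chains_uminus boundary_uminus)
qed (auto simp: cycle_group_def cycles_def chains_add boundary_add ac_simps)

lemma normal_boundaries:
  fixes F :: "'f::field itself"
  assumes "simplicial_complex (K :: 'v set set)"
  shows "boundaries d K \<lhd> cycle_group F d K"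
proof -
  interpret comm_group "cycle_group F d K"
    by (rule comm_group_cycle_group)
  have inv: "inv\<^bsub>cycle_group F d K\<^esub> x = - x" if "x \<in> cycles d K" for x
    using that by (intro inv_equality)
      (auto simp: cycle_group_def cycles_def chains_uminus boundary_uminus)
  have "subgroup (boundaries d K) (cycle_group F d K)"
  proof
    show "boundaries d K \<subseteq> carrier (cycle_group F d K)"
      using boundaries_subset_cycles[OF assms] by (simp add: cycle_group_def)
    show "\<one>\<^bsub>cycle_group F d K\<^esub> \<in> boundaries d K"
      by (auto simp: cycle_group_def boundaries_def intro!: image_eqI[of _ _ 0])
  next
    fix x y :: "'v set \<Rightarrow>\<^sub>0 'f"
    assume "x \<in> boundaries d K" "y \<in> boundaries d K"
    then show "x \<otimes>\<^bsub>cycle_group F d K\<^esub> y \<in> boundaries d K"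
      by (auto simp: cycle_group_def boundaries_def chains_add simp flip: boundary_add)
  next
    fix x :: "'v set \<Rightarrow>\<^sub>0 'f"
    assume x: "x \<in> boundaries d K"
    then have "- x \<in> boundaries d K"
      by (auto simp: boundaries_def chains_uminus simp flip: boundary_uminus)
    moreover have "x \<in> cycles d K"
      using x boundaries_subset_cycles[OF assms] by blast
    ultimately show "inv\<^bsub>cycle_group F d K\<^esub> x \<in> boundaries d K"
      using inv by simp
  qed
  then show ?thesis
    by (rule subgroup_imp_normal)
qed

lemma trivial_reduced_homology_iff:
  fixes F :: "'f::field itself"
  assumes "simplicial_complex K"
  shows "trivial_group (reduced_homology F d K) \<longleftrightarrow>
    (cycles d K :: ('v set \<Rightarrow>\<^sub>0 'f) set) \<subseteq> boundaries d K"
proof -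
  let ?Z = "cycle_group F d K" and ?B = "boundaries d K :: ('v set \<Rightarrow>\<^sub>0 'f) set"
  interpret comm_group ?Z
    by (rule comm_group_cycle_group)
  interpret B: normal ?B ?Z
    by (rule normal_boundaries[OF assms])
  have "trivial_group (?Z Mod ?B) \<longleftrightarrow> rcosets\<^bsub>?Z\<^esub> ?B = {?B}"
    using B.factorgroup_is_group by (simp add: trivial_group_def FactGroup_def)
  also have "\<dots> \<longleftrightarrow> carrier ?Z \<subseteq> ?B"
  proof
    assume *: "rcosets\<^bsub>?Z\<^esub> ?B = {?B}"
    show "carrier ?Z \<subseteq> ?B"
      using rcosets_part_G[OF B.is_subgroup] * by simp
  next
    assume "carrier ?Z \<subseteq> ?B"
    then have "?B #>\<^bsub>?Z\<^esub> x = ?B" if "x \<in> carrier ?Z" for x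
      using that B.is_subgroup by (meson coset_join2 subsetD)
    then show "rcosets\<^bsub>?Z\<^esub> ?B = {?B}"
      using one_closed by (auto simp: RCOSETS_def)
  qed
  finally show ?thesis
    by (simp add: reduced_homology_def cycle_group_def)
qed

lemma trivial_reduced_homology_minus_one_iff:
  fixes F :: "'f::field itself"
  assumes K: "simplicial_complex (K :: 'v set set)"
  shows "trivial_group (reduced_homology F (-1) K) \<longleftrightarrow> K \<noteq> {}"
proof
  assume triv: "trivial_group (reduced_homology F (-1) K)"
  show "K \<noteq> {}"
  proof
    assume "K = {}"
    then have "faces 0 K = {}"
      by (auto simp: faces_def)
    then have "boundaries (-1) K = {0 :: 'v set \<Rightarrow>\<^sub>0 'f}"
      by (simp add: boundaries_def simplicial_chains_def boundary_def)
    moreover have "Poly_Mapping.single {} 1 \<in> (cycles (-1) K :: ('v set \<Rightarrow>\<^sub>0 'f) set)"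
      by (simp add: cycles_def simplicial_chains_def faces_def boundary_single simplex_boundary_def)
    ultimately have "Poly_Mapping.single {} 1 = (0 :: 'v set \<Rightarrow>\<^sub>0 'f)"
      using triv by (auto simp: trivial_reduced_homology_iff[OF K])
    then show False
      by (metis lookup_single_eq lookup_zero zero_neq_one)
  qed
next
  assume "K \<noteq> {}"
  then obtain \<sigma> where \<sigma>: "\<sigma> \<in> K"
    by blast
  then obtain v where "v \<in> \<sigma>"
    using K unfolding simplicial_complex_def by (metis ex_in_conv)
  then have v: "{v} \<in> K"
    using K \<sigma> unfolding simplicial_complex_def
    by (metis empty_subsetI insert_not_empty insert_subset)
  have "{u \<in> {v}. u \<noteq> v \<and> (u, v) \<in> vertex_order} = {}"
    by blast
  then have pos: "position v {v} = 0"
    unfolding position_def by (metis card.empty)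
  have "c \<in> boundaries (-1) K" if "c \<in> cycles (-1) K" for c :: "'v set \<Rightarrow>\<^sub>0 'f"
  proof -
    have "Poly_Mapping.keys c \<subseteq> {{}}"
      using that by (auto simp: cycles_def simplicial_chains_def faces_def)
    then have "c = Poly_Mapping.single {} (Poly_Mapping.lookup c {})"
      by (intro poly_mapping_eqI) (auto simp: lookup_single when_def in_keys_iff)
    also have "\<dots> = boundary (Poly_Mapping.single {v} (Poly_Mapping.lookup c {}))"
      by (simp add: boundary_single simplex_boundary_def pos)
    also have "\<dots> \<in> boundaries (-1) K"
      using v by (auto simp: boundaries_def simplicial_chains_def faces_def)
    finally show ?thesis .
  qed
  then show "trivial_group (reduced_homology F (-1) K)"
    by (auto simp: trivial_reduced_homology_iff[OF K])
qed

end

theory Submission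
  imports Defs
begin

text \<open>
  Write \<open>I\<close> for the set of colours and \<open>r = m - k - 1\<close>. Condition (1) provides, for
  \<open>J \<subset> I\<close> and \<open>R \<subseteq> J\<close> with \<open>card (J - R) = r\<close>, chains \<open>e J R\<close> of dimension
  \<open>card R - 1\<close> in the subcomplex of \<open>K\<close> induced by \<open>J\<close>, such that the boundary of \<open>e J R\<close> is the
  alternating sum of the \<open>e (J - {j}) (R - {j})\<close>. They are chosen so that the alternating sum of the
  \<open>e J (Q - {q})\<close> vanishes if
  \<open>card Q \<ge> 2\<close>; hence the alternating sums of \<open>e (I - {j}) (R - {j})\<close> are
  cycles, compatible for varying \<open>R\<close>, and condition (2) provides chains \<open>g R\<close> for
  \<open>card R \<ge> k + 2\<close>, carried by the simplices that miss a colour of \<open>R\<close> (for \<open>R = I\<close> by \<open>K\<close>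
  itself, whose homology vanishes in degree \<open>m - 1\<close>), whose boundaries are these cycles for
  \<open>card R = k + 2\<close> and the alternating sums of \<open>g (R - {q})\<close> otherwise.

  Project everything to the full simplex on \<open>I\<close>. A Hopf trace argument shows that the
  trace of \<open>e J\<close> equals that of \<open>e (J - {p})\<close>, hence is \<open>1\<close>. Continuing it through the \<open>g R\<close>,
  whose diagonal coefficients vanish for \<open>R \<noteq> I\<close> because of the carriers, gives
  coefficient \<open>\<plusminus>1\<close> of \<open>g I\<close> at \<open>I\<close>. Hence \<open>g I\<close> involves a rainbow simplex.
\<close>

section \<open>Alternating sums over finite sets of indices\<close>

text \<open>Defined by negation alone, so that the same sign rules serve chains and field
  elements.\<close>

definition signed :: "nat \<Rightarrow> 'a \<Rightarrow> 'a::ab_group_add" where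
  "signed n x = (if even n then x else - x)"

lemma signed_zero [simp]: "signed n 0 = 0"
  by (simp add: signed_def)

lemma signed_eq_zero_iff [simp]: "signed n x = 0 \<longleftrightarrow> x = 0"
  by (simp add: signed_def)

lemma signed_signed: "signed m (signed n x) = signed (m + n) x"
  by (simp add: signed_def)

lemma signed_double [simp]: "signed n (signed n x) = x"
  by (simp add: signed_def)

lemma signed_add: "signed n (x + y) = signed n x + signed n y"
  by (simp add: signed_def)

lemma signed_diff: "signed n (x - y) = signed n x - signed n y"
  by (simp add: signed_def)

lemma signed_uminus: "signed n (- x) = - signed n x"
  by (simp add: signed_def)

lemma signed_sum: "signed n (sum f A) = (\<Sum>x\<in>A. signed n (f x))"
  by (simp add: signed_def sum_negf)

lemma signed_Suc [simp]: "signed (Suc n) x = - signed n x"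
  by (simp add: signed_def)

lemma signed_opposite: "(even m \<longleftrightarrow> odd n) \<Longrightarrow> signed m x = - signed n x"
  by (auto simp: signed_def)

lemma signed_eq_power: "(-1) ^ n * a = signed n (a :: 'f::field)"
  by (simp add: signed_def)

text \<open>The index \<open>j\<close> may lie outside \<open>R\<close>; then this is the rank that
  it has in \<open>insert j R\<close>.\<close>

definition rank :: "nat \<Rightarrow> nat set \<Rightarrow> nat" where
  "rank j R = card {i \<in> R. i < j}"

lemma rank_insert:
  assumes "finite R" "i \<notin> R"
  shows "rank j (insert i R) = (if i < j then Suc (rank j R) else rank j R)"
proof -
  have "{a \<in> insert i R. a < j} = (if i < j then insert i {a \<in> R. a < j} else {a \<in> R. a < j})"
    by auto
  then show ?thesis
    using assms by (auto simp: rank_def)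
qed

lemma rank_remove_self [simp]: "rank j (R - {j}) = rank j R"
  unfolding rank_def by (rule arg_cong[where f = card]) auto

lemma rank_insert_self [simp]: "rank j (insert j R) = rank j R"
  unfolding rank_def by (rule arg_cong[where f = card]) auto

lemma rank_remove:
  assumes "finite R" "i \<in> R"
  shows "rank j R = (if i < j then Suc (rank j (R - {i})) else rank j (R - {i}))"
  using rank_insert[of "R - {i}" i j] assms by (simp add: insert_absorb)

text \<open>When \<open>u j\<close> is a function of \<open>R - {j}\<close>, this is the simplicial
  boundary formula for the simplex \<open>R\<close> on the indices.\<close>

definition alt :: "nat set \<Rightarrow> (nat \<Rightarrow> 'a) \<Rightarrow> 'a::ab_group_add" where
  "alt R u = (\<Sum>j\<in>R. signed (rank j R) (u j))"

lemma alt_cong: "(\<And>j. j \<in> R \<Longrightarrow> u j = v j) \<Longrightarrow> alt R u = alt R v"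
  by (simp add: alt_def)

lemma alt_zero: "(\<And>j. j \<in> R \<Longrightarrow> u j = 0) \<Longrightarrow> alt R u = 0"
  by (simp add: alt_def)

lemma alt_empty [simp]: "alt {} u = 0"
  by (simp add: alt_def)

lemma alt_diff: "alt R (\<lambda>j. u j - v j) = alt R u - alt R v"
  by (simp add: alt_def signed_diff sum_subtractf)

lemma alt_insert:
  assumes "finite R" "p \<notin> R"
  shows "alt (insert p R) u =
    signed (rank p R) (u p) + (\<Sum>j\<in>R. signed (rank j (insert p R)) (u j))"
  using assms by (simp add: alt_def)

lemma alt_isolate:
  assumes "finite R" "p \<in> R" "\<And>j. j \<in> R - {p} \<Longrightarrow> u j = 0"
  shows "alt R u = signed (rank p R) (u p)"
  using assms by (simp add: alt_def sum.remove[of R p])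

text \<open>Deleting the smaller of two indices lowers the rank of the larger by one, while deleting
  the larger leaves the rank of the smaller alone. Hence the terms for \<open>(i, j)\<close> and
  \<open>(j, i)\<close> carry opposite signs and can be paired.\<close>

lemma alt_alt:
  assumes fin: "finite R"
  shows "alt R (\<lambda>i. alt (R - {i}) (\<lambda>j. H i j)) =
    (\<Sum>(i, j) | i \<in> R \<and> j \<in> R \<and> i < j. signed (rank i R + rank j R) (H j i - H i j))"
proof -
  define g where "g i j = signed (rank i R + rank j (R - {i})) (H i j)" for i j
  define P where "P = {(i, j). i \<in> R \<and> j \<in> R \<and> i < j}"
  define Q where "Q = {(i, j). i \<in> R \<and> j \<in> R \<and> j < i}"
  have "P \<subseteq> R \<times> R" "Q \<subseteq> R \<times> R"
    by (auto simp: P_def Q_def)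
  then have finPQ: "finite P" "finite Q"
    using fin by (meson finite_SigmaI finite_subset)+
  have disj: "P \<inter> Q = {}"
    by (auto simp: P_def Q_def)
  have un: "Sigma R (\<lambda>i. R - {i}) = P \<union> Q"
    by (auto simp: P_def Q_def)
  have "alt R (\<lambda>i. alt (R - {i}) (\<lambda>j. H i j)) = (\<Sum>i\<in>R. \<Sum>j\<in>R - {i}. g i j)"
    by (simp add: alt_def signed_sum signed_signed g_def)
  also have "\<dots> = (\<Sum>(i, j)\<in>P \<union> Q. g i j)"
    using fin by (simp add: sum.Sigma un)
  also have "\<dots> = (\<Sum>(i, j)\<in>P. g i j) + (\<Sum>(i, j)\<in>Q. g i j)"
    using finPQ disj by (simp add: sum.union_disjoint)
  also have "(\<Sum>(i, j)\<in>Q. g i j) = (\<Sum>(i, j)\<in>P. g j i)"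
    by (rule sum.reindex_bij_witness[of _ "\<lambda>(i, j). (j, i)" "\<lambda>(i, j). (j, i)"])
      (auto simp: P_def Q_def)
  also have "(\<Sum>(i, j)\<in>P. g i j) + (\<Sum>(i, j)\<in>P. g j i) = (\<Sum>(i, j)\<in>P. g i j + g j i)"
    by (simp add: sum.distrib case_prod_unfold)
  also have "\<dots> = (\<Sum>(i, j)\<in>P. signed (rank i R + rank j R) (H j i - H i j))"
  proof (intro sum.cong refl, clarify)
    fix i j
    assume "(i, j) \<in> P"
    then have "rank j R = Suc (rank j (R - {i}))" "rank i (R - {j}) = rank i R"
      using rank_remove[OF fin, of i j] rank_remove[OF fin, of j i] by (auto simp: P_def)
    then show "g i j + g j i = signed (rank i R + rank j R) (H j i - H i j)"
      by (simp add: g_def signed_diff add.commute)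
  qed
  finally show ?thesis
    by (simp add: P_def)
qed

text \<open>The abstract form of the rule that a boundary has boundary zero.\<close>

lemma alt_alt_symmetric:
  assumes "finite R" "\<And>i j. i \<in> R \<Longrightarrow> j \<in> R \<Longrightarrow> H i j = H j i"
  shows "alt R (\<lambda>i. alt (R - {i}) (\<lambda>j. H i j)) = 0"
  unfolding alt_alt[OF assms(1)] using assms(2) by (intro sum.neutral) auto

lemma alt_alt_swap:
  assumes "finite R"
  shows "alt R (\<lambda>i. alt (R - {i}) (\<lambda>j. H i j)) = - alt R (\<lambda>i. alt (R - {i}) (\<lambda>j. H j i))"
  unfolding alt_alt[OF assms] sum_negf[symmetric]
  by (intro sum.cong) (auto simp: signed_diff)

section \<open>Traces\<close>

definition subsets :: "nat set \<Rightarrow> nat \<Rightarrow> nat set set" where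
  "subsets J n = {U. U \<subseteq> J \<and> card U = n}"

lemma finite_subsets: "finite J \<Longrightarrow> finite (subsets J n)"
  by (simp add: subsets_def)

definition trace :: "nat set \<Rightarrow> nat \<Rightarrow> (nat set \<Rightarrow> nat set \<Rightarrow> 'a) \<Rightarrow> 'a::ab_group_add" where
  "trace J n a = (\<Sum>U\<in>subsets J n. a U U)"

text \<open>The trace is split along a vertex \<open>p\<close>, which plays the role of the apex of a cone
  contracting the full simplex. The off-diagonal term below enters the two identities
  \<open>sum_signed_coboundary\<close> and \<open>sum_signed_alt\<close> with opposite signs.\<close>

definition off_trace ::
    "nat set \<Rightarrow> nat \<Rightarrow> nat \<Rightarrow> (nat set \<Rightarrow> nat set \<Rightarrow> 'a) \<Rightarrow> 'a::ab_group_add" where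
  "off_trace J p n a = (\<Sum>W\<in>subsets (J - {p}) n. \<Sum>t\<in>J - {p} - W.
     signed (rank p W + rank t W) (a (insert p W) (insert t W)))"

lemma trace_Suc:
  assumes "finite J" "p \<in> J"
  shows "trace J (Suc n) a =
    (\<Sum>W\<in>subsets (J - {p}) n. a (insert p W) (insert p W)) + trace (J - {p}) (Suc n) a"
proof -
  have fin: "finite W" if "W \<subseteq> J" for W
    using assms that finite_subset by blast
  have split: "subsets J (Suc n) = insert p ` subsets (J - {p}) n \<union> subsets (J - {p}) (Suc n)"
  proof (intro equalityI subsetI)
    fix U assume U: "U \<in> subsets J (Suc n)"
    show "U \<in> insert p ` subsets (J - {p}) n \<union> subsets (J - {p}) (Suc n)"
    proof (cases "p \<in> U")
      case True
      then have "U = insert p (U - {p})" "U - {p} \<in> subsets (J - {p}) n"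
        using U fin[of U] by (auto simp: subsets_def card_Diff_singleton)
      then show ?thesis by blast
    qed (use U in \<open>auto simp: subsets_def\<close>)
  next
    fix U assume "U \<in> insert p ` subsets (J - {p}) n \<union> subsets (J - {p}) (Suc n)"
    then show "U \<in> subsets J (Suc n)"
    proof
      assume "U \<in> insert p ` subsets (J - {p}) n"
      then obtain W where W: "U = insert p W" "W \<subseteq> J - {p}" "card W = n"
        by (auto simp: subsets_def)
      moreover have "finite W" "p \<notin> W"
        using W fin[of W] by auto
      ultimately show ?thesis
        using assms(2) by (auto simp: subsets_def)
    qed (auto simp: subsets_def)
  qed
  have inj: "inj_on (insert p) (subsets (J - {p}) n)"
    by (rule inj_on_inverseI[where g = "\<lambda>U. U - {p}"]) (auto simp: subsets_def)
  have "insert p ` subsets (J - {p}) n \<inter> subsets (J - {p}) (Suc n) = {}"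
    by (auto simp: subsets_def)
  then show ?thesis
    unfolding trace_def split using assms(1)
    by (simp add: sum.union_disjoint finite_subsets sum.reindex[OF inj])
qed

text \<open>In the applications the inner sum is the coefficient at \<open>W\<close> of the boundary
  of the chain indexed by \<open>insert p W\<close>. The term \<open>t = p\<close> carries the sign
  of \<open>rank p W\<close> twice and gives a diagonal entry; the other terms form
  \<open>off_trace\<close>.\<close>

lemma sum_signed_coboundary:
  assumes "finite J" "p \<in> J"
  shows "(\<Sum>W\<in>subsets (J - {p}) n. signed (rank p W)
      (\<Sum>t\<in>J - W. signed (rank t W) (a (insert p W) (insert t W)))) =
    (\<Sum>W\<in>subsets (J - {p}) n. a (insert p W) (insert p W)) + off_trace J p n a"
  unfolding off_trace_def sum.distrib[symmetric]
proof (intro sum.cong refl)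
  fix W assume "W \<in> subsets (J - {p}) n"
  then have W: "p \<in> J - W" "finite (J - W)"
    using assms by (auto simp: subsets_def)
  have "J - W - {p} = J - {p} - W"
    by auto
  then show "signed (rank p W) (\<Sum>t\<in>J - W. signed (rank t W) (a (insert p W) (insert t W))) =
      a (insert p W) (insert p W) +
      (\<Sum>t\<in>J - {p} - W. signed (rank p W + rank t W) (a (insert p W) (insert t W)))"
    using W by (simp add: sum.remove[of _ p] signed_add signed_sum signed_signed)
qed

text \<open>The term \<open>q = p\<close> gives the diagonal entry at \<open>U\<close>. A term
  \<open>q = i\<close> with \<open>i\<close> in \<open>U\<close> is an off-diagonal entry for
  \<open>W = U - {i}\<close> and \<open>t = i\<close>, with the opposite sign.\<close>

lemma sum_signed_alt:
  assumes "finite J"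
  shows "(\<Sum>U\<in>subsets (J - {p}) (Suc n). signed (rank p U)
      (alt (insert p U) (\<lambda>q. a (insert p U - {q}) U))) =
    trace (J - {p}) (Suc n) a - off_trace J p n a"
proof -
  let ?S = "subsets (J - {p})"
  have fin: "finite W" if "W \<subseteq> J - {p}" for W
    using assms that by (meson finite_Diff finite_subset)
  have "(\<Sum>U\<in>?S (Suc n). signed (rank p U) (alt (insert p U) (\<lambda>q. a (insert p U - {q}) U))) =
      (\<Sum>U\<in>?S (Suc n). a U U +
        (\<Sum>i\<in>U. signed (rank p U + rank i (insert p U)) (a (insert p U - {i}) U)))"
  proof (intro sum.cong refl)
    fix U assume "U \<in> ?S (Suc n)"
    then have "finite U" "p \<notin> U"
      using fin by (auto simp: subsets_def)
    then show "signed (rank p U) (alt (insert p U) (\<lambda>q. a (insert p U - {q}) U)) = a U U +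
        (\<Sum>i\<in>U. signed (rank p U + rank i (insert p U)) (a (insert p U - {i}) U))"
      by (simp add: alt_insert signed_add signed_sum signed_signed)
  qed
  also have "\<dots> = trace (J - {p}) (Suc n) a +
      (\<Sum>(U, i)\<in>Sigma (?S (Suc n)) (\<lambda>U. U).
        signed (rank p U + rank i (insert p U)) (a (insert p U - {i}) U))"
  proof -
    have "\<forall>U\<in>?S (Suc n). finite U"
      using fin by (auto simp: subsets_def)
    then show ?thesis
      using assms by (simp add: trace_def sum.distrib finite_subsets sum.Sigma)
  qed
  also have "(\<Sum>(U, i)\<in>Sigma (?S (Suc n)) (\<lambda>U. U).
        signed (rank p U + rank i (insert p U)) (a (insert p U - {i}) U)) =
      (\<Sum>(W, t)\<in>Sigma (?S n) (\<lambda>W. J - {p} - W).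
        - signed (rank p W + rank t W) (a (insert p W) (insert t W)))"
  proof -
    have 1: "insert i (U - {i}) = U \<and> U - {i} \<in> ?S n \<and> i \<in> J - {p} - (U - {i}) \<and>
        - signed (rank p (U - {i}) + rank i (U - {i}))
          (a (insert p (U - {i})) (insert i (U - {i}))) =
        signed (rank p U + rank i (insert p U)) (a (insert p U - {i}) U)"
      if "U \<in> ?S (Suc n)" "i \<in> U" for U i
    proof -
      have U: "U \<subseteq> J - {p}" "card U = Suc n" "i \<in> U" "finite U" "i \<noteq> p" "p \<notin> U"
        using that fin by (auto simp: subsets_def)
      have eq: "insert p (U - {i}) = insert p U - {i}" "insert i (U - {i}) = U"
        using U by auto
      \<comment> \<open>Exactly one of \<open>i < p\<close> and \<open>p < i\<close> holds, so of
        the two ranks exactly one differs between the two sides, and by one.\<close>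
      have "even (rank p (U - {i}) + rank i (U - {i})) \<longleftrightarrow>
          odd (rank p U + rank i (insert p U))"
        using U rank_remove[of U i p] rank_insert[of U p i] by auto
      then have "- signed (rank p (U - {i}) + rank i (U - {i}))
          (a (insert p (U - {i})) (insert i (U - {i}))) =
        signed (rank p U + rank i (insert p U)) (a (insert p U - {i}) U)"
        unfolding eq by (metis signed_opposite minus_minus)
      moreover have "U - {i} \<in> ?S n" "i \<in> J - {p} - (U - {i})"
        using U by (auto simp: subsets_def)
      ultimately show ?thesis
        using eq(2) by blast
    qed
    have 2: "insert t W - {t} = W \<and> insert t W \<in> ?S (Suc n)"
      if "W \<in> ?S n" "t \<in> J - {p} - W" for W t
      using that fin[of W] by (auto simp: subsets_def)
    show ?thesis
    proof (rule sum.reindex_bij_witness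
        [of _ "\<lambda>(W, t). (insert t W, t)" "\<lambda>(U, i). (U - {i}, i)"])
      fix x assume "x \<in> Sigma (?S (Suc n)) (\<lambda>U. U)"
      then obtain U i where x: "x = (U, i)" "U \<in> ?S (Suc n)" "i \<in> U"
        by blast
      note 1[OF x(2,3)]
      then show "(case case x of (U, i) \<Rightarrow> (U - {i}, i) of (W, t) \<Rightarrow> (insert t W, t)) = x"
        "(case x of (U, i) \<Rightarrow> (U - {i}, i)) \<in> Sigma (?S n) (\<lambda>W. J - {p} - W)"
        "(case case x of (U, i) \<Rightarrow> (U - {i}, i) of (W, t) \<Rightarrow>
            - signed (rank p W + rank t W) (a (insert p W) (insert t W))) =
          (case x of (U, i) \<Rightarrow> signed (rank p U + rank i (insert p U)) (a (insert p U - {i}) U))"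
        unfolding x(1) prod.case by blast+
    next
      fix x assume "x \<in> Sigma (?S n) (\<lambda>W. J - {p} - W)"
      then obtain W t where x: "x = (W, t)" "W \<in> ?S n" "t \<in> J - {p} - W"
        by blast
      note 2[OF x(2,3)]
      then show "(case case x of (W, t) \<Rightarrow> (insert t W, t) of (U, i) \<Rightarrow> (U - {i}, i)) = x"
        "(case x of (W, t) \<Rightarrow> (insert t W, t)) \<in> Sigma (?S (Suc n)) (\<lambda>U. U)"
        unfolding x(1) prod.case by blast+
    qed
  qed
  also have "\<dots> = - off_trace J p n a"
    using assms by (simp add: off_trace_def sum_negf finite_subsets sum.Sigma case_prod_unfold)
  finally show ?thesis
    by simp
qed

section \<open>Chains\<close>

lemma boundary_signed: "boundary (signed n c) = signed n (boundary c)"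
  by (simp add: signed_def boundary_uminus)

lemma boundary_alt: "boundary (alt R u) = alt R (\<lambda>j. boundary (u j))"
  by (simp add: alt_def boundary_sum boundary_signed)

lemma chains_signed:
  "c \<in> simplicial_chains d K \<Longrightarrow> signed n c \<in> simplicial_chains d K"
  by (simp add: signed_def chains_uminus)

lemma chains_alt:
  "(\<And>j. j \<in> R \<Longrightarrow> u j \<in> simplicial_chains d K) \<Longrightarrow> alt R u \<in> simplicial_chains d K"
  by (simp add: alt_def chains_sum chains_signed)

lemma chains_mono:
  "c \<in> simplicial_chains d K \<Longrightarrow> K \<subseteq> L \<Longrightarrow> c \<in> simplicial_chains d L"
  by (auto simp: simplicial_chains_def faces_def)

lemma cycle_is_boundary:
  fixes c :: "'v set \<Rightarrow>\<^sub>0 'f::field"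
  assumes "simplicial_complex K" "trivial_group (reduced_homology TYPE('f) d K)"
    and "c \<in> simplicial_chains d K" "boundary c = 0"
  obtains b where "b \<in> simplicial_chains (d + 1) K" "boundary b = c"
proof -
  have "c \<in> boundaries d K"
    using assms trivial_reduced_homology_iff[OF assms(1), of "TYPE('f)" d]
    by (auto simp: cycles_def)
  then show thesis
    using that by (auto simp: boundaries_def)
qed

lemma subcomplex:
  assumes "simplicial_complex K" "L \<subseteq> K"
    and "\<And>\<sigma> \<tau>. \<sigma> \<in> L \<Longrightarrow> \<tau> \<subseteq> \<sigma> \<Longrightarrow> \<tau> \<in> K \<Longrightarrow> \<tau> \<in> L"
  shows "simplicial_complex L"
  using assms unfolding simplicial_complex_def by (meson subsetD)

lemma simplicial_complex_colour_induced:
  "simplicial_complex K \<Longrightarrow> simplicial_complex (colour_induced V K S)"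
  by (rule subcomplex) (auto simp: colour_induced_def)

lemma simplicial_complex_colour_missing:
  "simplicial_complex K \<Longrightarrow> simplicial_complex (colour_missing V K S)"
  by (rule subcomplex) (auto simp: colour_missing_def colours_def, blast)

section \<open>Coherent families of chains built from the first homology condition\<close>

text \<open>The family \<open>e J R\<close> with \<open>R\<close> ranging over the subsets of \<open>J\<close> with
  \<open>card J - r\<close> elements. The cocycle condition in the last line says that \<open>e J\<close> factors
  through the simplicial boundary of the full simplex on \<open>J\<close>.\<close>

definition coherent ::
    "(nat \<Rightarrow> 'v set) \<Rightarrow> 'v set set \<Rightarrow> nat \<Rightarrow> (nat set \<Rightarrow> nat set \<Rightarrow> ('v set \<Rightarrow>\<^sub>0 'f::field)) \<Rightarrow>
      nat set \<Rightarrow> bool" where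
  "coherent V K r e J \<longleftrightarrow>
    (card J = r \<longrightarrow> e J {} = Poly_Mapping.single {} 1) \<and>
    (\<forall>R\<subseteq>J. card R + r = card J \<longrightarrow>
      e J R \<in> simplicial_chains (int (card R) - 1) (colour_induced V K J) \<and>
      boundary (e J R) = alt R (\<lambda>j. e (J - {j}) (R - {j}))) \<and>
    (\<forall>Q\<subseteq>J. 2 \<le> card Q \<longrightarrow> card Q + r = Suc (card J) \<longrightarrow> alt Q (\<lambda>q. e J (Q - {q})) = 0)"

lemma coherentD:
  assumes "coherent V K r e J"
  shows "card J = r \<Longrightarrow> e J {} = Poly_Mapping.single {} 1"
    and "R \<subseteq> J \<Longrightarrow> card R + r = card J \<Longrightarrow>
      e J R \<in> simplicial_chains (int (card R) - 1) (colour_induced V K J)"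
    and "R \<subseteq> J \<Longrightarrow> card R + r = card J \<Longrightarrow> boundary (e J R) = alt R (\<lambda>j. e (J - {j}) (R - {j}))"
    and "Q \<subseteq> J \<Longrightarrow> 2 \<le> card Q \<Longrightarrow> card Q + r = Suc (card J) \<Longrightarrow> alt Q (\<lambda>q. e J (Q - {q})) = 0"
  using assms by (auto simp: coherent_def)

text \<open>The boundary is a double alternating sum whose terms depend only on the unordered pair
  of deleted indices.\<close>

lemma coherent_remove_cycle:
  assumes "finite R" "R \<subseteq> J" "finite J" "card R + r = card J"
    and e: "\<And>j. j \<in> R \<Longrightarrow> coherent V K r e (J - {j})"
  shows "boundary (alt R (\<lambda>j. e (J - {j}) (R - {j}))) = 0"
proof -
  have "boundary (alt R (\<lambda>j. e (J - {j}) (R - {j}))) =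
      alt R (\<lambda>j. alt (R - {j}) (\<lambda>i. e (J - {j} - {i}) (R - {j} - {i})))"
    unfolding boundary_alt
  proof (rule alt_cong)
    fix j assume "j \<in> R"
    then have "card R = Suc (card (R - {j}))" "card J = Suc (card (J - {j}))"
      using assms by (meson card.remove subsetD)+
    then have "card (R - {j}) + r = card (J - {j})"
      using assms(4) by linarith
    then show "boundary (e (J - {j}) (R - {j})) =
        alt (R - {j}) (\<lambda>i. e (J - {j} - {i}) (R - {j} - {i}))"
      using coherentD(3)[OF e[OF \<open>j \<in> R\<close>], of "R - {j}"] assms(2) by auto
  qed
  also have "\<dots> = 0"
    by (rule alt_alt_symmetric[OF assms(1)]) (metis Diff_insert Diff_insert2)
  finally show ?thesis .
qed

text \<open>Exchanging the two deletions turns the inner sums into cocycle conditions of the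
  families \<open>e (J - {j})\<close>. For \<open>card Q = 2\<close> no such condition is at hand,
  as it would make \<open>e (J - {j}) {}\<close> vanish; but then all terms equal
  \<open>Poly_Mapping.single {} 1\<close> and cancel by symmetry.\<close>

lemma coherent_remove_cocycle:
  assumes J: "finite J" and Q: "Q \<subseteq> J" "card Q + r = Suc (card J)" "2 \<le> card Q"
    and e: "\<And>j. j \<in> J \<Longrightarrow> coherent V K r e (J - {j})"
  shows "alt Q (\<lambda>q. alt (Q - {q}) (\<lambda>j. e (J - {j}) (Q - {q} - {j}))) = 0"
proof (cases "card Q = 2")
  have fin: "finite Q"
    using J Q(1) finite_subset by blast
  case True
  show ?thesis
  proof (rule alt_alt_symmetric[OF fin])
    have *: "e (J - {j}) (Q - {q} - {j}) = Poly_Mapping.single {} 1 \<or> j = q"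
      if "q \<in> Q" "j \<in> Q" for q j
    proof -
      have "Q - {q} - {j} = {}" if "j \<noteq> q"
      proof -
        have "card (Q - {q} - {j}) = 0"
          using that \<open>q \<in> Q\<close> \<open>j \<in> Q\<close> True fin by (simp add: card_Diff_singleton)
        then show ?thesis
          using fin by simp
      qed
      moreover have "card (J - {j}) = r"
        using J True that Q by (auto simp: card_Diff_singleton)
      ultimately show ?thesis
        using coherentD(1)[OF e[of j]] that Q(1) by (metis subsetD)
    qed
    fix i j assume "i \<in> Q" "j \<in> Q"
    then show "e (J - {j}) (Q - {i} - {j}) = e (J - {i}) (Q - {j} - {i})"
      using *[of i j] *[of j i] by auto
  qed
next
  have fin: "finite Q"
    using J Q(1) finite_subset by blast
  case False
  have "alt Q (\<lambda>q. alt (Q - {q}) (\<lambda>j. e (J - {j}) (Q - {q} - {j}))) =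
      - alt Q (\<lambda>j. alt (Q - {j}) (\<lambda>q. e (J - {j}) (Q - {q} - {j})))"
    by (rule alt_alt_swap[OF fin])
  also have "alt Q (\<lambda>j. alt (Q - {j}) (\<lambda>q. e (J - {j}) (Q - {q} - {j}))) = 0"
  proof (rule alt_zero)
    fix j assume j: "j \<in> Q"
    have "Q - {q} - {j} = Q - {j} - {q}" for q
      by auto
    moreover have "alt (Q - {j}) (\<lambda>q. e (J - {j}) (Q - {j} - {q})) = 0"
      using j Q J False fin by (intro coherentD(4)[OF e]) (auto simp: card_Diff_singleton)
    ultimately show "alt (Q - {j}) (\<lambda>q. e (J - {j}) (Q - {q} - {j})) = 0"
      by simp
  qed
  finally show ?thesis
    by simp
qed

text \<open>Arbitrary fillings of the cycles \<open>w R\<close> need not satisfy the cocycle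
  condition. Those with \<open>p\<close> in \<open>R\<close> are kept, and the others are replaced
  by the values which the condition forces, as in contracting a cone with apex
  \<open>p\<close>.\<close>

lemma coherent_extend:
  fixes e :: "nat set \<Rightarrow> nat set \<Rightarrow> ('v set \<Rightarrow>\<^sub>0 'f::field)"
  assumes K: "simplicial_complex K" and J: "finite J" "card J = Suc n + r"
    and triv: "trivial_group (reduced_homology TYPE('f) (int n - 1) (colour_induced V K J))"
    and e: "\<And>j. j \<in> J \<Longrightarrow> coherent V K r e (J - {j})"
  shows "\<exists>f. coherent V K r (e(J := f)) J"
proof -
  define w where "w R = alt R (\<lambda>j. e (J - {j}) (R - {j}))" for R
  obtain p where p: "p \<in> J"
    using J by fastforce
  have fin: "finite R" if "R \<subseteq> J" for R
    using J(1) that finite_subset by blast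
  have w_chain: "w R \<in> simplicial_chains (int n - 1) (colour_induced V K J)"
    if "R \<subseteq> J" "card R = Suc n" for R
    unfolding w_def
  proof (rule chains_alt)
    fix j assume j: "j \<in> R"
    then have "card (R - {j}) = n" "card (J - {j}) = n + r"
      using that J fin[of R] by (auto simp: card_Diff_singleton)
    then have "e (J - {j}) (R - {j}) \<in>
        simplicial_chains (int n - 1) (colour_induced V K (J - {j}))"
      using coherentD(2)[OF e, of j "R - {j}"] j that(1) by auto
    then show "e (J - {j}) (R - {j}) \<in> simplicial_chains (int n - 1) (colour_induced V K J)"
      by (rule chains_mono) (auto simp: colour_induced_def)
  qed
  have w_cycle: "boundary (w R) = 0" if "R \<subseteq> J" "card R = Suc n" for R
    unfolding w_def using that J e fin[of R] by (intro coherent_remove_cycle) auto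
  have w_cocycle: "alt Q (\<lambda>q. w (Q - {q})) = 0" if "Q \<subseteq> J" "card Q = Suc (Suc n)" for Q
    unfolding w_def using that J e by (intro coherent_remove_cocycle) auto
  have "\<exists>b. b \<in> simplicial_chains (int n) (colour_induced V K J) \<and> boundary b = w R"
    if "R \<subseteq> J" "card R = Suc n" for R
    using cycle_is_boundary[OF simplicial_complex_colour_induced[OF K] triv
        w_chain[OF that] w_cycle[OF that]]
    by (metis diff_add_cancel)
  then obtain b where b: "\<And>R. R \<subseteq> J \<Longrightarrow> card R = Suc n \<Longrightarrow>
      b R \<in> simplicial_chains (int n) (colour_induced V K J) \<and> boundary (b R) = w R"
    by metis
  \<comment> \<open>For \<open>p\<close> outside \<open>R\<close>, the value solves the cocycle
    equation of \<open>insert p R\<close> for its term at \<open>p\<close>.\<close>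
  define f where "f R = (if p \<in> R then b R else
      - signed (rank p R) (\<Sum>j\<in>R. signed (rank j (insert p R)) (b (insert p R - {j}))))" for R
  have cocycle_p: "alt Q (\<lambda>q. f (Q - {q})) = 0" if "Q \<subseteq> J" "p \<in> Q" for Q
  proof -
    define R where "R = Q - {p}"
    have R: "finite R" "p \<notin> R" "Q = insert p R"
      using that fin by (auto simp: R_def)
    have "insert p R - {p} = R"
      using R by auto
    moreover have "f (insert p R - {j}) = b (insert p R - {j})" if "j \<in> R" for j
      using that R by (auto simp: f_def)
    ultimately show ?thesis
      using R by (simp add: alt_insert f_def signed_uminus)
  qed
  have cocycle: "alt Q (\<lambda>q. f (Q - {q})) = 0" if Q: "Q \<subseteq> J" for Q
  proof (cases "p \<in> Q")
    case False
    let ?Q = "insert p Q"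
    \<comment> \<open>Every inner sum with \<open>i \<noteq> p\<close> runs over a set that contains
      \<open>p\<close> and is zero already. Since the double sum vanishes, the remaining inner sum,
      which is the one over \<open>Q\<close>, vanishes too.\<close>
    have "alt ?Q (\<lambda>i. alt (?Q - {i}) (\<lambda>j. f (?Q - {i} - {j}))) =
        signed (rank p ?Q) (alt (?Q - {p}) (\<lambda>j. f (?Q - {p} - {j})))"
      using Q p fin[OF Q] by (intro alt_isolate cocycle_p) auto
    moreover have "alt ?Q (\<lambda>i. alt (?Q - {i}) (\<lambda>j. f (?Q - {i} - {j}))) = 0"
      using fin[OF Q] by (intro alt_alt_symmetric) (auto intro: arg_cong[where f = f])
    moreover have "?Q - {p} = Q"
      using False by auto
    ultimately show ?thesis
      by simp
  qed (use cocycle_p Q in auto)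
  have f_chain: "f R \<in> simplicial_chains (int n) (colour_induced V K J)"
    if R: "R \<subseteq> J" "card R = Suc n" for R
  proof (cases "p \<in> R")
    case False
    have "b (insert p R - {j}) \<in> simplicial_chains (int n) (colour_induced V K J)"
      if "j \<in> R" for j
      using that R p False fin[OF R(1)] b[of "insert p R - {j}"] by (auto simp: card_Diff_singleton)
    then show ?thesis
      using False by (auto simp: f_def intro!: chains_uminus chains_signed chains_sum)
  qed (use b R in \<open>simp add: f_def\<close>)
  have f_boundary: "boundary (f R) = w R" if R: "R \<subseteq> J" "card R = Suc n" for R
  proof (cases "p \<in> R")
    case False
    let ?Q = "insert p R"
    have Q: "?Q \<subseteq> J" "card ?Q = Suc (Suc n)" "finite ?Q" "?Q - {p} = R"
      using R p False fin[OF R(1)] by auto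
    \<comment> \<open>Both \<open>boundary (f R)\<close> and \<open>w R\<close> satisfy the cocycle
      condition, and they agree on the sets that contain \<open>p\<close>; so they agree on
      \<open>R\<close> as well.\<close>
    have "alt ?Q (\<lambda>q. boundary (f (?Q - {q})) - w (?Q - {q})) = 0"
      using cocycle[OF Q(1)] w_cocycle[OF Q(1,2)] by (simp add: alt_diff flip: boundary_alt)
    moreover have "alt ?Q (\<lambda>q. boundary (f (?Q - {q})) - w (?Q - {q})) =
        signed (rank p ?Q) (boundary (f (?Q - {p})) - w (?Q - {p}))"
    proof (rule alt_isolate)
      fix q assume "q \<in> ?Q - {p}"
      then show "boundary (f (?Q - {q})) - w (?Q - {q}) = 0"
        using b[of "?Q - {q}"] Q by (auto simp: f_def card_Diff_singleton)
    qed (use Q in auto)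
    ultimately show ?thesis
      using Q(4) by simp
  qed (use b R in \<open>simp add: f_def\<close>)
  have "coherent V K r (e(J := f)) J"
    unfolding coherent_def
  proof (intro conjI allI impI)
    fix R assume R: "R \<subseteq> J" "card R + r = card J"
    then have c: "card R = Suc n"
      using J by simp
    show "(e(J := f)) J R \<in> simplicial_chains (int (card R) - 1) (colour_induced V K J)"
      using f_chain R c by simp
    have "boundary (f R) = alt R (\<lambda>j. (e(J := f)) (J - {j}) (R - {j}))"
      unfolding f_boundary[OF R(1) c] w_def using R(1) by (intro alt_cong) auto
    then show "boundary ((e(J := f)) J R) = alt R (\<lambda>j. (e(J := f)) (J - {j}) (R - {j}))"
      by simp
  next
    fix Q assume "Q \<subseteq> J"
    then show "alt Q (\<lambda>q. (e(J := f)) J (Q - {q})) = 0"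
      using cocycle by simp
  qed (use J in auto)
  then show ?thesis
    by (rule exI[of _ f])
qed

text \<open>Allows a family to be redefined on larger index sets, or on others of the same size,
  without disturbing what is known at \<open>J\<close>.\<close>

lemma coherent_cong:
  assumes "\<And>J'. J' \<subseteq> J \<Longrightarrow> e J' = e' J'"
  shows "coherent V K r e J \<longleftrightarrow> coherent V K r e' J"
proof -
  have "e (J - {j}) = e' (J - {j})" "e J = e' J" for j
    using assms by auto
  then show ?thesis
    by (simp add: coherent_def)
qed

text \<open>Induction on the excess of \<open>card J\<close> over \<open>r\<close>. Extensions to
  different sets \<open>J\<close> of equal size do not interact, so all of them can be chosen at
  once.\<close>

lemma coherent_exists:
  fixes K :: "'v set set"
  assumes K: "simplicial_complex K" and I: "finite I"
    and triv: "\<And>J. J \<subseteq> I \<Longrightarrow> r < card J \<Longrightarrow> card J \<le> r + n \<Longrightarrow>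
      trivial_group (reduced_homology TYPE('f::field) (int (card J) - int r - 2) (colour_induced V K J))"
  shows "\<exists>e :: nat set \<Rightarrow> nat set \<Rightarrow> ('v set \<Rightarrow>\<^sub>0 'f).
    \<forall>J\<subseteq>I. r \<le> card J \<longrightarrow> card J \<le> r + n \<longrightarrow> coherent V K r e J"
  using triv
proof (induction n)
  case 0
  \<comment> \<open>At the lowest level only \<open>R = {}\<close> occurs, and the cocycle condition
    is void because it would concern sets \<open>Q\<close> with one element.\<close>
  have "coherent V K r (\<lambda>_ _. Poly_Mapping.single {} 1 :: 'v set \<Rightarrow>\<^sub>0 'f) J"
    if "J \<subseteq> I" "card J = r" for J
    unfolding coherent_def
  proof (intro conjI allI impI)
    fix R assume "R \<subseteq> J" "card R + r = card J"
    then have "R = {}"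
      using that I by (metis add_eq_self_zero add.commute card_0_eq finite_subset)
    then show "Poly_Mapping.single {} 1 \<in> simplicial_chains (int (card R) - 1) (colour_induced V K J)"
      "boundary (Poly_Mapping.single {} 1 :: 'v set \<Rightarrow>\<^sub>0 'f) = alt R (\<lambda>j. Poly_Mapping.single {} 1)"
      by (simp_all add: simplicial_chains_def faces_def boundary_single simplex_boundary_def)
  qed (use that in auto)
  then show ?case
    by (metis add_0_right le_antisym)
next
  case (Suc n)
  then obtain e :: "nat set \<Rightarrow> nat set \<Rightarrow> ('v set \<Rightarrow>\<^sub>0 'f)" where
    e: "\<And>J. J \<subseteq> I \<Longrightarrow> r \<le> card J \<Longrightarrow> card J \<le> r + n \<Longrightarrow> coherent V K r e J"
    by (metis le_SucI add_Suc_right)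
  have "\<exists>f. coherent V K r (e(J := f)) J" if J: "J \<subseteq> I" "card J = Suc n + r" for J
  proof (rule coherent_extend[OF K _ J(2)])
    show "finite J"
      using I J(1) finite_subset by blast
    show "trivial_group (reduced_homology TYPE('f) (int n - 1) (colour_induced V K J))"
      using Suc.prems[OF J(1)] J(2) by simp
    show "coherent V K r e (J - {j})" if "j \<in> J" for j
      using that J by (intro e) (auto simp: card_Diff_singleton)
  qed
  then obtain f where f: "\<And>J. J \<subseteq> I \<Longrightarrow> card J = Suc n + r \<Longrightarrow> coherent V K r (e(J := f J)) J"
    by metis
  define e' where "e' J = (if card J = Suc n + r then f J else e J)" for J
  have "coherent V K r e' J" if J: "J \<subseteq> I" "r \<le> card J" "card J \<le> r + Suc n" for J
  proof -
    have less: "card J' < card J" if "J' \<subset> J" for J'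
      using that J I by (meson finite_subset psubset_card_mono)
    show ?thesis
    proof (cases "card J = Suc n + r")
      case True
      have "e' J' = (e(J := f J)) J'" if "J' \<subseteq> J" for J'
        using less[of J'] True by (cases "J' = J") (auto simp: e'_def psubset_eq that)
      then have "coherent V K r e' J \<longleftrightarrow> coherent V K r (e(J := f J)) J"
        by (rule coherent_cong)
      then show ?thesis
        using f[OF J(1) True] by simp
    next
      case False
      have "e' J' = e J'" if "J' \<subseteq> J" for J'
        using less[of J'] False J by (cases "J' = J") (auto simp: e'_def psubset_eq that)
      then have "coherent V K r e' J \<longleftrightarrow> coherent V K r e J"
        by (rule coherent_cong)
      then show ?thesis
        using e[OF J(1,2)] False J by simp
    qed
  qed
  then show ?case
    by blast
qed

section \<open>Compatible fillings over index sets of growing size\<close>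

text \<open>At each size, the alternating sum of the chains chosen for the sets
  \<open>R - {q}\<close> is a cycle of \<open>L R\<close>, and the vanishing homology of
  \<open>L R\<close> fills it. The number \<open>N\<close> bounds the sizes treated so far.\<close>

lemma exists_compatible_fillings:
  fixes z :: "nat set \<Rightarrow> ('v set \<Rightarrow>\<^sub>0 'f::field)" and L :: "nat set \<Rightarrow> 'v set set"
  assumes I: "finite I"
    and L: "\<And>R. R \<subseteq> I \<Longrightarrow> simplicial_complex (L R)"
      "\<And>R q. R \<subseteq> I \<Longrightarrow> L (R - {q}) \<subseteq> L R"
    and triv: "\<And>R. R \<subseteq> I \<Longrightarrow> n \<le> card R \<Longrightarrow>
      trivial_group (reduced_homology TYPE('f) (int (card R) - 2) (L R))"
    and z: "\<And>R. R \<subseteq> I \<Longrightarrow> card R = n \<Longrightarrow> z R \<in> simplicial_chains (int n - 2) (L R)"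
      "\<And>R. R \<subseteq> I \<Longrightarrow> card R = n \<Longrightarrow> boundary (z R) = 0"
      "\<And>Q. Q \<subseteq> I \<Longrightarrow> card Q = Suc n \<Longrightarrow> alt Q (\<lambda>q. z (Q - {q})) = 0"
  shows "\<exists>g. \<forall>R\<subseteq>I. n \<le> card R \<longrightarrow> card R \<le> n + N \<longrightarrow>
    g R \<in> simplicial_chains (int (card R) - 1) (L R) \<and>
    boundary (g R) = (if card R = n then z R else alt R (\<lambda>q. g (R - {q})))"
proof (induction N)
  case 0
  have "\<exists>b. b \<in> simplicial_chains (int (card R) - 1) (L R) \<and> boundary b = z R"
    if "R \<subseteq> I" "card R = n" for R
    using cycle_is_boundary[OF L(1)[OF that(1)] triv[OF that(1)], of "z R"] z(1,2)[OF that] that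
    by auto
  then obtain g where "\<And>R. R \<subseteq> I \<Longrightarrow> card R = n \<Longrightarrow>
      g R \<in> simplicial_chains (int (card R) - 1) (L R) \<and> boundary (g R) = z R"
    by metis
  then show ?case
    by (intro exI[of _ g]) auto
next
  case (Suc N)
  then obtain g where g: "\<And>R. R \<subseteq> I \<Longrightarrow> n \<le> card R \<Longrightarrow> card R \<le> n + N \<Longrightarrow>
      g R \<in> simplicial_chains (int (card R) - 1) (L R) \<and>
      boundary (g R) = (if card R = n then z R else alt R (\<lambda>q. g (R - {q})))"
    by blast
  have "\<exists>b. b \<in> simplicial_chains (int (card R) - 1) (L R) \<and> boundary b = alt R (\<lambda>q. g (R - {q}))"
    if R: "R \<subseteq> I" "card R = Suc (n + N)" for R
  proof -
    have fin: "finite R"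
      using I R(1) finite_subset by blast
    have card: "card (R - {q}) = n + N" if "q \<in> R" for q
      using that R(2) fin by simp
    have sub: "R - {q} \<subseteq> I" for q
      using R(1) by auto
    have "alt R (\<lambda>q. g (R - {q})) \<in> simplicial_chains (int (card R) - 2) (L R)"
    proof (rule chains_alt)
      fix q assume q: "q \<in> R"
      have "g (R - {q}) \<in> simplicial_chains (int (card R) - 2) (L (R - {q}))"
        using g[OF sub[of q]] card[OF q] R(2) by simp
      then show "g (R - {q}) \<in> simplicial_chains (int (card R) - 2) (L R)"
        using L(2)[OF R(1)] chains_mono by blast
    qed
    moreover have "boundary (alt R (\<lambda>q. g (R - {q}))) = 0"
    \<comment> \<open>One level above the start the boundaries are the given
      \<open>z (R - {q})\<close>, whose cocycle condition is a hypothesis; further up it is a double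
      alternating sum that is zero.\<close>
    proof (cases "N = 0")
      case True
      have "boundary (alt R (\<lambda>q. g (R - {q}))) = alt R (\<lambda>q. z (R - {q}))"
        unfolding boundary_alt using g[OF sub] card True by (intro alt_cong) simp
      then show ?thesis
        using z(3)[OF R(1)] R(2) True by simp
    next
      case False
      have "boundary (alt R (\<lambda>q. g (R - {q}))) = alt R (\<lambda>q. alt (R - {q}) (\<lambda>j. g (R - {q} - {j})))"
        unfolding boundary_alt using g[OF sub] card False by (intro alt_cong) simp
      also have "\<dots> = 0"
        using fin by (intro alt_alt_symmetric) (auto intro: arg_cong[where f = g])
      finally show ?thesis .
    qed
    moreover have "trivial_group (reduced_homology TYPE('f) (int (card R) - 2) (L R))"
      using triv[OF R(1)] R(2) by simp
    ultimately obtain b where "b \<in> simplicial_chains (int (card R) - 2 + 1) (L R)"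
        "boundary b = alt R (\<lambda>q. g (R - {q}))"
      using cycle_is_boundary[OF L(1)[OF R(1)]] by metis
    then show ?thesis
      by (auto simp: algebra_simps)
  qed
  then obtain b where b: "\<And>R. R \<subseteq> I \<Longrightarrow> card R = Suc (n + N) \<Longrightarrow>
      b R \<in> simplicial_chains (int (card R) - 1) (L R) \<and> boundary (b R) = alt R (\<lambda>q. g (R - {q}))"
    by metis
  define g' where "g' R = (if card R = Suc (n + N) then b R else g R)" for R
  have "g' R \<in> simplicial_chains (int (card R) - 1) (L R) \<and>
      boundary (g' R) = (if card R = n then z R else alt R (\<lambda>q. g' (R - {q})))"
    if R: "R \<subseteq> I" "n \<le> card R" "card R \<le> n + Suc N" for R
  proof -
    have "finite R"
      using I R(1) finite_subset by blast
    then have "card (R - {q}) \<noteq> Suc (n + N)" if "q \<in> R" for q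
      using that R(3) card_Diff1_less[of R q] by linarith
    then have "alt R (\<lambda>q. g' (R - {q})) = alt R (\<lambda>q. g (R - {q}))"
      by (intro alt_cong) (simp add: g'_def)
    then show ?thesis
      using b[OF R(1)] g[OF R(1,2)] R(3) by (auto simp: g'_def)
  qed
  then show ?case
    by (intro exI[of _ g']) simp
qed

section \<open>Counting rainbow simplices with signs\<close>

lemma vertex_order_total: "u \<noteq> v \<Longrightarrow> (u, v) \<in> vertex_order \<longleftrightarrow> (v, u) \<notin> vertex_order"
  using linear_vertex_order
  by (auto simp: linear_order_on_def partial_order_on_def total_on_def antisym_def)

lemma position_insert:
  assumes "finite \<sigma>" "y \<notin> \<sigma>" "y \<noteq> x"
  shows "position x (insert y \<sigma>) =
    (if (y, x) \<in> vertex_order then Suc (position x \<sigma>) else position x \<sigma>)"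
proof -
  have "{u \<in> insert y \<sigma>. u \<noteq> x \<and> (u, x) \<in> vertex_order} =
      (if (y, x) \<in> vertex_order then insert y {u \<in> \<sigma>. u \<noteq> x \<and> (u, x) \<in> vertex_order}
       else {u \<in> \<sigma>. u \<noteq> x \<and> (u, x) \<in> vertex_order})"
    using assms by auto
  then show ?thesis
    using assms by (auto simp: position_def)
qed

lemma position_insert_self [simp]: "position x (insert x \<sigma>) = position x \<sigma>"
  unfolding position_def by (rule arg_cong[where f = card]) auto

text \<open>If \<open>col\<close> is injective on \<open>\<sigma>\<close>, its parity is the sign of
  the permutation that turns the vertex order into the order of the colours.\<close>

definition inversions :: "('v \<Rightarrow> nat) \<Rightarrow> 'v set \<Rightarrow> nat" where
  "inversions col \<sigma> =
     card {(u, v). u \<in> \<sigma> \<and> v \<in> \<sigma> \<and> u \<noteq> v \<and> (u, v) \<in> vertex_order \<and> col v < col u}"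

lemma even_card_sym_diff:
  assumes "finite A" "finite B"
  shows "even (card ((A - B) \<union> (B - A)) + (card A + card B))"
proof -
  have "card A = card (A \<inter> B) + card (A - B)" "card B = card (A \<inter> B) + card (B - A)"
    using assms by (metis card_Int_Diff Int_commute)+
  moreover have "card ((A - B) \<union> (B - A)) = card (A - B) + card (B - A)"
    using assms by (intro card_Un_disjoint) auto
  ultimately show ?thesis
    by presburger
qed

text \<open>An inverted pair with \<open>x\<close> comes from a vertex that precedes
  \<open>x\<close> in exactly one of the two orders, so there are as many as elements in a symmetric
  difference. Its size has the parity of \<open>card A + card B\<close>, which are the position and
  the rank.\<close>

lemma inversions_insert:
  assumes "finite \<tau>" "x \<notin> \<tau>" "inj_on col (insert x \<tau>)"
  shows "even (inversions col (insert x \<tau>) + inversions col \<tau> +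
    position x \<tau> + rank (col x) (col ` \<tau>))"
proof -
  define P where "P \<sigma> = {(u, v). u \<in> \<sigma> \<and> v \<in> \<sigma> \<and> u \<noteq> v \<and> (u, v) \<in> vertex_order \<and> col v < col u}"
    for \<sigma>
  define A where "A = {u \<in> \<tau>. u \<noteq> x \<and> (u, x) \<in> vertex_order}"
  define B where "B = {u \<in> \<tau>. col u < col x}"
  have fin: "finite A" "finite B"
    using assms(1) by (auto simp: A_def B_def)
  have ne: "col u \<noteq> col x" "u \<noteq> x" if "u \<in> \<tau>" for u
    using that assms by (auto simp: inj_on_def)
  have vo: "(x, u) \<in> vertex_order \<longleftrightarrow> (u, x) \<notin> vertex_order" if "u \<in> \<tau>" for u
    using vertex_order_total[of x u] ne that by metis
  have "P \<tau> \<subseteq> \<tau> \<times> \<tau>"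
    by (auto simp: P_def)
  then have finP: "finite (P \<tau>)"
    using assms(1) by (meson finite_SigmaI finite_subset)
  have "P (insert x \<tau>) = P \<tau> \<union> ((\<lambda>u. (u, x)) ` (A - B) \<union> (\<lambda>u. (x, u)) ` (B - A))"
  proof (intro equalityI subsetI)
    fix q assume "q \<in> P (insert x \<tau>)"
    then show "q \<in> P \<tau> \<union> ((\<lambda>u. (u, x)) ` (A - B) \<union> (\<lambda>u. (x, u)) ` (B - A))"
      using vo by (force simp: P_def A_def B_def)
  next
    fix q assume "q \<in> P \<tau> \<union> ((\<lambda>u. (u, x)) ` (A - B) \<union> (\<lambda>u. (x, u)) ` (B - A))"
    then show "q \<in> P (insert x \<tau>)"
      using vo ne by (auto simp: P_def A_def B_def nat_neq_iff)
  qed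
  moreover have "P \<tau> \<inter> ((\<lambda>u. (u, x)) ` (A - B) \<union> (\<lambda>u. (x, u)) ` (B - A)) = {}"
    using assms(2) by (auto simp: P_def)
  ultimately have "card (P (insert x \<tau>)) =
      card (P \<tau>) + card ((\<lambda>u. (u, x)) ` (A - B) \<union> (\<lambda>u. (x, u)) ` (B - A))"
    using finP fin by (simp add: card_Un_disjoint)
  also have "card ((\<lambda>u. (u, x)) ` (A - B) \<union> (\<lambda>u. (x, u)) ` (B - A)) = card (A - B) + card (B - A)"
    using fin assms(2)
    by (subst card_Un_disjoint) (auto simp: A_def B_def card_image inj_on_def)
  also have "card (A - B) + card (B - A) = card ((A - B) \<union> (B - A))"
    using fin by (intro card_Un_disjoint[symmetric]) auto
  finally have "inversions col (insert x \<tau>) = inversions col \<tau> + card ((A - B) \<union> (B - A))"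
    by (simp add: inversions_def P_def)
  moreover have "position x \<tau> = card A"
    by (simp add: position_def A_def)
  moreover have "rank (col x) (col ` \<tau>) = card B"
  proof -
    have "{i \<in> col ` \<tau>. i < col x} = col ` B"
      by (auto simp: B_def)
    moreover have "inj_on col B"
      using assms(3) by (rule inj_on_subset) (auto simp: B_def)
    ultimately show ?thesis
      by (simp add: rank_def card_image)
  qed
  ultimately show ?thesis
    using even_card_sym_diff[OF fin] by presburger
qed

section \<open>The chain map induced by the colouring\<close>

text \<open>A simplex with a repeated colour has a degenerate image and counts as zero.\<close>

definition weight :: "('v \<Rightarrow> nat) \<Rightarrow> nat set \<Rightarrow> 'v set \<Rightarrow> 'f \<Rightarrow> 'f::field" where
  "weight col T \<sigma> a =
     (if inj_on col \<sigma> \<and> col ` \<sigma> = T then signed (inversions col \<sigma>) a else 0)"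

text \<open>The sign of a simplex compares the order on its vertices with the order on their
  colours; with it, \<open>coef\<close> is the coefficient at \<open>T\<close> of the chain map induced by the
  simplicial map \<open>col\<close>.\<close>

definition coef :: "('v \<Rightarrow> nat) \<Rightarrow> ('v set \<Rightarrow>\<^sub>0 'f) \<Rightarrow> nat set \<Rightarrow> 'f::field" where
  "coef col c T = (\<Sum>\<sigma>\<in>Poly_Mapping.keys c. weight col T \<sigma> (Poly_Mapping.lookup c \<sigma>))"

lemma weight_zero [simp]: "weight col T \<sigma> 0 = 0"
  by (simp add: weight_def)

lemma coef_superset:
  assumes "finite A" "Poly_Mapping.keys c \<subseteq> A"
  shows "coef col c T = (\<Sum>\<sigma>\<in>A. weight col T \<sigma> (Poly_Mapping.lookup c \<sigma>))"
  unfolding coef_def using assms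
  by (intro sum.mono_neutral_left) (auto simp: in_keys_iff)

lemma coef_zero [simp]: "coef col 0 T = 0"
  by (simp add: coef_def)

lemma coef_add: "coef col (c + d) T = coef col c T + coef col d T"
proof -
  let ?A = "Poly_Mapping.keys c \<union> Poly_Mapping.keys d"
  have "Poly_Mapping.keys (c + d) \<subseteq> ?A"
    by (rule keys_add)
  then show ?thesis
    by (simp add: coef_superset[of ?A] lookup_add weight_def signed_add sum.distrib[symmetric])
      (intro sum.cong, auto simp: weight_def signed_add)
qed

lemma coef_uminus: "coef col (- c) T = - coef col c T"
  using coef_add[of col c "- c" T] by (simp add: eq_neg_iff_add_eq_0 add.commute)

lemma coef_signed: "coef col (signed n c) T = signed n (coef col c T)"
  by (simp add: signed_def coef_uminus)

lemma coef_sum: "coef col (sum f A) T = (\<Sum>x\<in>A. coef col (f x) T)"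
  by (induction A rule: infinite_finite_induct) (simp_all add: coef_add)

lemma coef_alt: "coef col (alt R u) T = alt R (\<lambda>j. coef col (u j) T)"
  by (simp add: alt_def coef_sum coef_signed)

lemma coef_single: "coef col (Poly_Mapping.single \<sigma> a) T = weight col T \<sigma> a"
  by (simp add: coef_superset[of "{\<sigma>}"])

text \<open>The chain map property on one simplex. If no facet maps bijectively onto
  \<open>U\<close>, both sides vanish. If the facet opposite \<open>v\<close> does, then either
  \<open>col v\<close> is a new colour and one equal term survives on each side, or a vertex
  \<open>w\<close> shares it and the facets opposite \<open>v\<close> and \<open>w\<close>
  cancel.\<close>

lemma coef_simplex_boundary:
  fixes a :: "'f::field"
  assumes "finite \<sigma>" "finite I" "col ` \<sigma> \<subseteq> I"
  shows "coef col (simplex_boundary \<sigma> a) U =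
    (\<Sum>t\<in>I - U. signed (rank t U) (weight col (insert t U) \<sigma> a))"
proof -
  define full where "full T \<tau> \<longleftrightarrow> inj_on col \<tau> \<and> col ` \<tau> = T" for T \<tau>
  define h where "h v = weight col U (\<sigma> - {v}) (signed (position v \<sigma>) a)" for v
  have lhs: "coef col (simplex_boundary \<sigma> a) U = (\<Sum>v\<in>\<sigma>. h v)"
    by (simp add: simplex_boundary_def coef_sum coef_single signed_eq_power h_def)
  have h_zero: "h v = 0" if "\<not> full U (\<sigma> - {v})" for v
    using that by (auto simp: h_def weight_def full_def)
  have h_full: "h v = signed (inversions col (\<sigma> - {v}) + position v \<sigma>) a" if "full U (\<sigma> - {v})" for v
    using that by (simp add: h_def weight_def full_def signed_signed)
  have w_zero: "weight col T \<sigma> a = 0" if "\<not> full T \<sigma>" for T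
    using that by (auto simp: weight_def full_def)
  show ?thesis
  proof (cases "\<exists>v\<in>\<sigma>. full U (\<sigma> - {v})")
    case False
    have "\<not> full (insert t U) \<sigma>" if "t \<notin> U" for t
    proof
      assume *: "full (insert t U) \<sigma>"
      then obtain v where v: "v \<in> \<sigma>" "col v = t"
        unfolding full_def by (metis imageE insertI1)
      then have "col ` (\<sigma> - {v}) = insert t U - {t}"
        using * inj_on_image_set_diff[of col \<sigma> \<sigma> "{v}"] by (auto simp: full_def)
      then have "full U (\<sigma> - {v})"
        using * that by (auto simp: full_def inj_on_def)
      then show False
        using False v by blast
    qed
    then show ?thesis
      using False h_zero w_zero unfolding lhs by simp
  next
    case True
    then obtain v where v: "v \<in> \<sigma>" "full U (\<sigma> - {v})"
      by blast
    define \<tau> where "\<tau> = \<sigma> - {v}"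
    have \<tau>: "\<sigma> = insert v \<tau>" "v \<notin> \<tau>" "finite \<tau>" "inj_on col \<tau>" "col ` \<tau> = U"
      using v assms(1) by (auto simp: \<tau>_def full_def)
    show ?thesis
    proof (cases "col v \<in> U")
      case False
      have inj: "inj_on col \<sigma>" "col ` \<sigma> = insert (col v) U"
        using \<tau> False by auto
      have "(\<Sum>v\<in>\<sigma>. h v) = h v"
      proof (subst sum.remove[OF assms(1) v(1)])
        have "h w = 0" if "w \<in> \<sigma> - {v}" for w
        proof (rule h_zero)
          have "col v \<in> col ` (\<sigma> - {w})"
            using that v by blast
          then show "\<not> full U (\<sigma> - {w})"
            using False by (auto simp: full_def)
        qed
        then show "h v + sum h (\<sigma> - {v}) = h v"
          by simp
      qed
      moreover have "(\<Sum>t\<in>I - U. signed (rank t U) (weight col (insert t U) \<sigma> a)) =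
          signed (rank (col v) U) (weight col (insert (col v) U) \<sigma> a)"
      proof (subst sum.remove[of _ "col v"])
        have "weight col (insert t U) \<sigma> a = 0" if "t \<in> I - U - {col v}" for t
          using that inj False by (intro w_zero) (auto simp: full_def)
        then show "signed (rank (col v) U) (weight col (insert (col v) U) \<sigma> a) +
            (\<Sum>t\<in>I - U - {col v}. signed (rank t U) (weight col (insert t U) \<sigma> a)) =
            signed (rank (col v) U) (weight col (insert (col v) U) \<sigma> a)"
          by simp
      qed (use assms v False in auto)
      moreover have "h v = signed (rank (col v) U) (weight col (insert (col v) U) \<sigma> a)"
      proof -
        \<comment> \<open>The sign of the facet in the boundary, corrected by the change in
          inversions, is the sign of the colour \<open>col v\<close> in the image.\<close>
        have "even (inversions col \<sigma> + inversions col \<tau> + position v \<tau> + rank (col v) U)"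
          using inversions_insert[of \<tau> v col] \<tau> inj by simp
        moreover have "position v \<sigma> = position v \<tau>"
          by (simp add: \<tau>(1))
        ultimately have "even (inversions col \<tau> + position v \<sigma>) \<longleftrightarrow>
            even (rank (col v) U + inversions col \<sigma>)"
          by presburger
        moreover have "weight col (insert (col v) U) \<sigma> a = signed (inversions col \<sigma>) a"
          using inj by (simp add: weight_def)
        ultimately show ?thesis
          unfolding h_full[OF v(2)] by (simp add: signed_signed \<tau>_def signed_def)
      qed
      ultimately show ?thesis
        unfolding lhs by simp
    next
      case True
      then obtain w where w: "w \<in> \<tau>" "col w = col v"
        using \<tau>(5) by auto
      define \<rho> where "\<rho> = \<tau> - {w}"
      have \<rho>: "\<tau> = insert w \<rho>" "w \<notin> \<rho>" "v \<notin> \<rho>" "finite \<rho>" "v \<noteq> w"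
        using \<tau> w by (auto simp: \<rho>_def)
      have rem: "\<sigma> - {v} = insert w \<rho>" "\<sigma> - {w} = insert v \<rho>" "\<sigma> = insert v (insert w \<rho>)"
        using \<tau> \<rho> by auto
      have injw: "inj_on col (insert w \<rho>)"
        using \<tau> \<rho> by simp
      then have injv: "inj_on col (insert v \<rho>)"
        using w(2) \<rho> by (auto simp: inj_on_def)
      have "col ` insert v \<rho> = U"
        using w(2) \<tau>(5) \<rho>(1) by auto
      then have fw: "full U (\<sigma> - {w})"
        unfolding full_def rem(2) using injv by blast
      have "(\<Sum>v\<in>\<sigma>. h v) = (\<Sum>v\<in>{v, w}. h v)"
      proof (rule sum.mono_neutral_right)
        show "\<forall>x\<in>\<sigma> - {v, w}. h x = 0"
        proof
          fix x assume "x \<in> \<sigma> - {v, w}"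
          then have "\<not> inj_on col (\<sigma> - {x})"
            using w(2) \<rho>(5) rem(3) by (auto simp: inj_on_def)
          then show "h x = 0"
            by (intro h_zero) (simp add: full_def)
        qed
      qed (use assms(1) rem(3) in auto)
      also have "\<dots> = h v + h w"
        using \<rho>(5) by simp
      also have "\<dots> = 0"
      proof -
        have "even (inversions col (insert w \<rho>) + inversions col \<rho> + position w \<rho> + rank (col w) (col ` \<rho>))"
          "even (inversions col (insert v \<rho>) + inversions col \<rho> + position v \<rho> + rank (col w) (col ` \<rho>))"
          using inversions_insert[of \<rho> w col] inversions_insert[of \<rho> v col] \<rho> injw injv w(2) by simp_all
        \<comment> \<open>One of \<open>v\<close> and \<open>w\<close> precedes the other, so
          inserting both into \<open>\<rho>\<close> raises exactly one of their two
          positions.\<close>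
        moreover have "odd (position v \<sigma> + position w \<sigma> + position v \<rho> + position w \<rho>)"
        proof -
          have "position v \<sigma> = position v (insert w \<rho>)"
            unfolding rem(3) by (rule position_insert_self)
          moreover have "position w \<sigma> = position w (insert v \<rho>)"
            unfolding rem(3) insert_commute[of v w] by (rule position_insert_self)
          ultimately show ?thesis
            using \<rho> vertex_order_total[of v w]
            by (auto simp: position_insert)
        qed
        ultimately have "even (inversions col (insert w \<rho>) + position v \<sigma>) \<longleftrightarrow>
            odd (inversions col (insert v \<rho>) + position w \<sigma>)"
          by presburger
        then show ?thesis
          unfolding h_full[OF v(2)] h_full[OF fw] rem(1,2) signed_def by auto
      qed
      finally have "(\<Sum>v\<in>\<sigma>. h v) = 0" .
      moreover have "\<not> inj_on col \<sigma>"
        using w(2) \<rho>(5) rem(3) by (auto simp: inj_on_def)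
      then have "weight col T \<sigma> a = 0" for T
        by (intro w_zero) (simp add: full_def)
      ultimately show ?thesis
        unfolding lhs by simp
    qed
  qed
qed

lemma coef_boundary:
  assumes "finite I" "\<And>\<sigma>. \<sigma> \<in> Poly_Mapping.keys c \<Longrightarrow> finite \<sigma> \<and> col ` \<sigma> \<subseteq> I"
  shows "coef col (boundary c) U = (\<Sum>t\<in>I - U. signed (rank t U) (coef col c (insert t U)))"
proof -
  have "coef col (boundary c) U = (\<Sum>\<sigma>\<in>Poly_Mapping.keys c. \<Sum>t\<in>I - U.
      signed (rank t U) (weight col (insert t U) \<sigma> (Poly_Mapping.lookup c \<sigma>)))"
    unfolding boundary_def coef_sum
    using assms by (intro sum.cong refl coef_simplex_boundary) auto
  also have "\<dots> = (\<Sum>t\<in>I - U. signed (rank t U) (coef col c (insert t U)))"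
    by (subst sum.swap) (simp add: coef_def signed_sum)
  finally show ?thesis .
qed

section \<open>Coefficients of chains in coloured subcomplexes\<close>

definition properly_coloured ::
    "(nat \<Rightarrow> 'v set) \<Rightarrow> 'v set set \<Rightarrow> nat set \<Rightarrow> ('v \<Rightarrow> nat) \<Rightarrow> bool" where
  "properly_coloured V K I col \<longleftrightarrow>
    (\<forall>i\<in>I. \<forall>v\<in>V i. col v = i) \<and> (\<forall>\<sigma>\<in>K. \<sigma> \<subseteq> (\<Union>i\<in>I. V i))"

lemma properly_coloured_vertex:
  assumes "properly_coloured V K I col" "\<sigma> \<in> K" "v \<in> \<sigma>"
  shows "col v \<in> I" "v \<in> V (col v)"
proof -
  have "\<sigma> \<subseteq> (\<Union>i\<in>I. V i)"
    using assms(1,2) by (simp add: properly_coloured_def)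
  then obtain i where "i \<in> I" "v \<in> V i"
    using assms(3) by blast
  moreover from this have "col v = i"
    using assms(1) by (simp add: properly_coloured_def)
  ultimately show "col v \<in> I" "v \<in> V (col v)"
    by simp_all
qed

lemma coef_boundary_chain:
  assumes "properly_coloured V K I col" "finite I" "c \<in> simplicial_chains d K"
  shows "coef col (boundary c) U = (\<Sum>t\<in>I - U. signed (rank t U) (coef col c (insert t U)))"
proof (rule coef_boundary[OF assms(2)])
  fix \<sigma> assume "\<sigma> \<in> Poly_Mapping.keys c"
  then have "finite \<sigma>" "\<sigma> \<in> insert {} K"
    using assms(3) by (auto simp: simplicial_chains_def faces_def)
  then show "finite \<sigma> \<and> col ` \<sigma> \<subseteq> I"
    using properly_coloured_vertex(1)[OF assms(1)] by auto
qed

lemma coef_eq_zero: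
  assumes "\<And>\<sigma>. \<sigma> \<in> Poly_Mapping.keys c \<Longrightarrow> inj_on col \<sigma> \<Longrightarrow> col ` \<sigma> \<noteq> T"
  shows "coef col c T = 0"
  unfolding coef_def using assms by (intro sum.neutral) (auto simp: weight_def)

lemma coef_colour_induced:
  assumes col: "properly_coloured V K I col" and "J \<subseteq> I" "\<not> T \<subseteq> J"
    and c: "c \<in> simplicial_chains d (colour_induced V K J)"
  shows "coef col c T = 0"
proof (rule coef_eq_zero)
  fix \<sigma> assume "\<sigma> \<in> Poly_Mapping.keys c"
  then have "\<sigma> \<subseteq> (\<Union>i\<in>J. V i)"
    using c by (auto simp: simplicial_chains_def faces_def colour_induced_def)
  then have "col ` \<sigma> \<subseteq> J"
    using col assms(2) unfolding properly_coloured_def by fastforce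
  then show "col ` \<sigma> \<noteq> T"
    using assms(3) by blast
qed

text \<open>A simplex whose colours are exactly those in \<open>T\<close> has all colours of
  \<open>R\<close>, so it is no simplex of the subcomplex. The empty face, adjoined to every
  complex, is excluded by \<open>R \<noteq> {}\<close>.\<close>

lemma coef_colour_missing:
  assumes col: "properly_coloured V K I col" and "R \<subseteq> T" "R \<noteq> {}"
    and c: "c \<in> simplicial_chains d (colour_missing V K R)"
  shows "coef col c T = 0"
proof (rule coef_eq_zero)
  fix \<sigma> assume "\<sigma> \<in> Poly_Mapping.keys c"
  then have *: "\<sigma> = {} \<or> \<sigma> \<in> K \<and> \<not> R \<subseteq> colours V \<sigma>"
    using c by (auto simp: simplicial_chains_def faces_def colour_missing_def)
  have "col ` \<sigma> \<subseteq> colours V \<sigma>" if "\<sigma> \<in> K"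
    using properly_coloured_vertex(2)[OF col that] by (auto simp: colours_def)
  then show "col ` \<sigma> \<noteq> T"
    using * assms(2,3) by (metis image_is_empty subset_empty subset_trans)
qed

lemma colour_induced_all:
  assumes "properly_coloured V K I col"
  shows "colour_induced V K I = K"
  using assms by (auto simp: properly_coloured_def colour_induced_def)

section \<open>Traces of the projected families\<close>

text \<open>Since \<open>e (J - {j})\<close> does not use the colour \<open>j\<close>, only the index \<open>p\<close> contributes to
  the coefficient of the boundary of \<open>x (insert p W)\<close> at \<open>W\<close>.\<close>

lemma trace_remove:
  fixes x :: "nat set \<Rightarrow> ('v set \<Rightarrow>\<^sub>0 'f::field)"
  assumes col: "properly_coloured V K I col" and I: "finite I" and J: "J \<subseteq> I" "p \<in> J"
    and x: "\<And>W. W \<in> subsets (J - {p}) n \<Longrightarrow>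
        x (insert p W) \<in> simplicial_chains d (colour_induced V K J)"
      "\<And>W. W \<in> subsets (J - {p}) n \<Longrightarrow> boundary (x (insert p W)) =
        alt (insert p W) (\<lambda>j. e (J - {j}) (insert p W - {j}))"
    and e: "\<And>j R. j \<in> J \<Longrightarrow> R \<subseteq> J - {j} \<Longrightarrow> card R = n \<Longrightarrow>
        e (J - {j}) R \<in> simplicial_chains d' (colour_induced V K (J - {j}))"
  shows "(\<Sum>W\<in>subsets (J - {p}) n. coef col (x (insert p W)) (insert p W)) +
      off_trace J p n (\<lambda>R. coef col (x R)) = trace (J - {p}) n (\<lambda>R. coef col (e (J - {p}) R))"
proof -
  have finJ: "finite J"
    using I J(1) finite_subset by blast
  have "(\<Sum>W\<in>subsets (J - {p}) n. coef col (x (insert p W)) (insert p W)) +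
      off_trace J p n (\<lambda>R. coef col (x R)) =
      (\<Sum>W\<in>subsets (J - {p}) n. signed (rank p W)
        (\<Sum>t\<in>J - W. signed (rank t W) (coef col (x (insert p W)) (insert t W))))"
    by (rule sum_signed_coboundary[symmetric, OF finJ J(2)])
  also have "\<dots> = trace (J - {p}) n (\<lambda>R. coef col (e (J - {p}) R))"
    unfolding trace_def
  proof (intro sum.cong refl)
    fix W assume W: "W \<in> subsets (J - {p}) n"
    then have W': "W \<subseteq> J" "p \<notin> W" "finite W" "card W = n"
      using finJ finite_subset by (auto simp: subsets_def)
    have "x (insert p W) \<in> simplicial_chains d K"
      using x(1)[OF W] by (rule chains_mono) (auto simp: colour_induced_def)
    then have "coef col (boundary (x (insert p W))) W =
        (\<Sum>t\<in>I - W. signed (rank t W) (coef col (x (insert p W)) (insert t W)))"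
      by (rule coef_boundary_chain[OF col I])
    also have "\<dots> = (\<Sum>t\<in>J - W. signed (rank t W) (coef col (x (insert p W)) (insert t W)))"
    \<comment> \<open>The chain only uses colours of \<open>J\<close>, so indices outside
      \<open>J\<close> contribute nothing.\<close>
    proof (rule sum.mono_neutral_right)
      have "coef col (x (insert p W)) (insert t W) = 0" if "t \<notin> J" for t
        using that by (intro coef_colour_induced[OF col J(1) _ x(1)[OF W]]) auto
      then show "\<forall>t\<in>I - W - (J - W).
          signed (rank t W) (coef col (x (insert p W)) (insert t W)) = 0"
        by auto
    qed (use I J in auto)
    finally have "(\<Sum>t\<in>J - W. signed (rank t W) (coef col (x (insert p W)) (insert t W))) =
        alt (insert p W) (\<lambda>j. coef col (e (J - {j}) (insert p W - {j})) W)"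
      by (simp add: x(2)[OF W] coef_alt)
    also have "\<dots> = signed (rank p (insert p W)) (coef col (e (J - {p}) (insert p W - {p})) W)"
    proof (rule alt_isolate)
      fix j assume j: "j \<in> insert p W - {p}"
      have "card (insert p W - {j}) = n"
        using j W' by simp
      then show "coef col (e (J - {j}) (insert p W - {j})) W = 0"
        using j J W' by (intro coef_colour_induced[OF col _ _ e]) auto
    qed (use W' in auto)
    finally show "signed (rank p W)
        (\<Sum>t\<in>J - W. signed (rank t W) (coef col (x (insert p W)) (insert t W))) =
        coef col (e (J - {p}) W) W"
      using W'(2) by simp
  qed
  finally show ?thesis .
qed

text \<open>A Hopf trace argument. The boundary formula shows that the diagonal entries containing
  \<open>p\<close> plus the off-diagonal term give the trace for \<open>J - {p}\<close>; the cocycle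
  condition shows that the other diagonal entries minus the same term give zero. Adding the two, the
  trace for \<open>J\<close> equals that for \<open>J - {p}\<close>.\<close>

lemma trace_coherent:
  fixes e :: "nat set \<Rightarrow> nat set \<Rightarrow> ('v set \<Rightarrow>\<^sub>0 'f::field)"
  assumes col: "properly_coloured V K I col" and I: "finite I"
    and "J \<subseteq> I" "card J = n + r"
    and "\<And>J'. J' \<subseteq> J \<Longrightarrow> r \<le> card J' \<Longrightarrow> coherent V K r e J'"
  shows "trace J n (\<lambda>R. coef col (e J R)) = 1"
  using assms(3-)
proof (induction n arbitrary: J)
  case 0
  have "finite J"
    using I 0(1) finite_subset by blast
  then have "subsets J 0 = {{}}"
    by (auto simp: subsets_def card_eq_0_iff dest: finite_subset)
  moreover have "e J {} = Poly_Mapping.single {} 1"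
    using coherentD(1)[OF 0(3)[of J]] 0(2) by simp
  ultimately show ?case
    by (simp add: trace_def coef_single weight_def inversions_def signed_def)
next
  case (Suc n)
  have finJ: "finite J"
    using I Suc.prems(1) finite_subset by blast
  obtain p where p: "p \<in> J"
    using Suc.prems(2) by fastforce
  have e: "coherent V K r e (J - {j})" if "j \<in> J" for j
    using that Suc.prems(2) finJ by (intro Suc.prems(3)) auto
  have eJ: "coherent V K r e J"
    using Suc.prems by auto
  let ?a = "\<lambda>R. coef col (e J R)"
  have card: "insert p W \<subseteq> J" "card (insert p W) = Suc m"
    if "W \<in> subsets (J - {p}) m" for W m
  proof -
    have "finite W" "p \<notin> W" "W \<subseteq> J" "card W = m"
      using that finJ finite_subset[of W J] by (auto simp: subsets_def)
    then show "insert p W \<subseteq> J" "card (insert p W) = Suc m"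
      using p by auto
  qed
  have "(\<Sum>W\<in>subsets (J - {p}) n. ?a (insert p W) (insert p W)) + off_trace J p n ?a =
      trace (J - {p}) n (\<lambda>R. coef col (e (J - {p}) R))"
  proof (rule trace_remove[OF col I Suc.prems(1) p])
    fix W assume "W \<in> subsets (J - {p}) n"
    note W = card[OF this]
    show "e J (insert p W) \<in> simplicial_chains (int n) (colour_induced V K J)"
      using coherentD(2)[OF eJ W(1)] W(2) Suc.prems(2) by simp
    show "boundary (e J (insert p W)) = alt (insert p W) (\<lambda>j. e (J - {j}) (insert p W - {j}))"
      using coherentD(3)[OF eJ W(1)] W(2) Suc.prems(2) by simp
  next
    fix j R assume "j \<in> J" "R \<subseteq> J - {j}" "card R = n"
    then show "e (J - {j}) R \<in> simplicial_chains (int n - 1) (colour_induced V K (J - {j}))"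
      using coherentD(2)[OF e, of j R] Suc.prems(2) finJ by simp
  qed
  also have "\<dots> = 1"
    using p Suc.prems finJ by (intro Suc.IH) auto
  finally have 1: "(\<Sum>W\<in>subsets (J - {p}) n. ?a (insert p W) (insert p W)) + off_trace J p n ?a = 1" .
  have "trace (J - {p}) (Suc n) ?a - off_trace J p n ?a = (\<Sum>U\<in>subsets (J - {p}) (Suc n).
      signed (rank p U) (alt (insert p U) (\<lambda>q. ?a (insert p U - {q}) U)))"
    by (rule sum_signed_alt[symmetric, OF finJ])
  also have "\<dots> = 0"
  proof (intro sum.neutral ballI)
    fix U assume "U \<in> subsets (J - {p}) (Suc n)"
    note U = card[OF this]
    have "alt (insert p U) (\<lambda>q. e J (insert p U - {q})) = 0"
      using coherentD(4)[OF eJ U(1)] U(2) Suc.prems(2) by simp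
    then show "signed (rank p U) (alt (insert p U) (\<lambda>q. ?a (insert p U - {q}) U)) = 0"
      by (simp flip: coef_alt)
  qed
  finally show ?case
    using 1 by (simp add: trace_Suc[OF finJ p])
qed

section \<open>Propagation of the off-diagonal trace to the full set of colours\<close>

theorem theorem14:
  fixes K :: "'v set set" and V :: "nat \<Rightarrow> 'v set" and m :: nat and k :: int
  assumes "simplicial_complex K"
    and "vertices K = (\<Union>i\<in>{0..m}. V i)"
    and "disjoint_family_on V {0..m}"
    and "trivial_group (reduced_homology TYPE('f::field) (int m - 1) K)"
    and "-1 \<le> k" and "k \<le> int m - 1"
    and "\<And>S. S \<subseteq> {0..m} \<Longrightarrow> 1 \<le> int (card S) \<Longrightarrow> int (card S) \<le> k + 1 \<Longrightarrow>
      trivial_group (reduced_homology TYPE('f) (k - int (card S)) (colour_induced V K ({0..m} - S)))"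
    and "\<And>S. S \<subseteq> {0..m} \<Longrightarrow> k + 2 \<le> int (card S) \<Longrightarrow> int (card S) \<le> int m \<Longrightarrow>
      trivial_group (reduced_homology TYPE('f) (int (card S) - 2) (colour_missing V K S))"
  shows "\<exists>\<sigma>. rainbow_simplex m V K \<sigma>"
proof (rule ccontr)
  assume no_rainbow: "\<not> (\<exists>\<sigma>. rainbow_simplex m V K \<sigma>)"
  note K = assms(1)
  define I where "I = {0..m}"
  \<comment> \<open>Since \<open>k \<ge> -1\<close>, this is \<open>k + 1\<close> itself;
    \<open>k = -1\<close> gives \<open>n = 0\<close> and \<open>r = m\<close>.\<close>
  define n where "n = nat (k + 1)"
  define r where "r = m - n"
  have n: "int n = k + 1" "n \<le> m"
    using assms(5,6) by (auto simp: n_def)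
  have I: "finite I" "card I = Suc m" "card I = Suc n + r"
    using n by (auto simp: I_def r_def)
  have finite: "finite R" if "R \<subseteq> I" for R
    using that I(1) finite_subset by blast
  have card_eq: "R = I" if "R \<subseteq> I" "card R = Suc m" for R
    using that I by (metis card_subset_eq)
  \<comment> \<open>Disjointness makes the colour unique. Off the classes the value is unspecified,
    but no vertex of \<open>K\<close> lies there.\<close>
  define col where "col v = (THE i. i \<in> I \<and> v \<in> V i)" for v
  have col_eq: "col v = i" if "i \<in> I" "v \<in> V i" for i v
    unfolding col_def
  proof (rule the_equality)
    show "\<And>j. j \<in> I \<and> v \<in> V j \<Longrightarrow> j = i"
      using that assms(3) unfolding I_def disjoint_family_on_def by blast
  qed (use that in auto)
  have col: "properly_coloured V K I col"
    using assms(2) col_eq by (auto simp: properly_coloured_def vertices_def I_def)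

  \<comment> \<open>This is condition (1) for the complement \<open>S = I - J\<close>: sizes of
    \<open>J\<close> from \<open>r + 1\<close> to \<open>r + n\<close> correspond to sizes of
    \<open>S\<close> from \<open>k + 1\<close> down to \<open>1\<close>.\<close>
  have "trivial_group (reduced_homology TYPE('f) (int (card J) - int r - 2) (colour_induced V K J))"
    if J: "J \<subseteq> I" "r < card J" "card J \<le> r + n" for J
  proof -
    have "card (I - J) = card I - card J"
      using J(1) finite[OF J(1)] by (simp add: card_Diff_subset)
    then have c: "int (card (I - J)) = int n + 1 + int r - int (card J)"
      using I(3) J by simp
    have eq: "I - (I - J) = J"
      using J(1) by blast
    have "trivial_group (reduced_homology TYPE('f) (k - int (card (I - J))) (colour_induced V K J))"
      using assms(7)[folded I_def, of "I - J"] c n J unfolding eq by fastforce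
    moreover have "k - int (card (I - J)) = int (card J) - int r - 2"
      using c n by simp
    ultimately show ?thesis
      by simp
  qed
  then obtain e :: "nat set \<Rightarrow> nat set \<Rightarrow> ('v set \<Rightarrow>\<^sub>0 'f)" where
    e: "\<And>J. J \<subseteq> I \<Longrightarrow> r \<le> card J \<Longrightarrow> card J \<le> r + n \<Longrightarrow> coherent V K r e J"
    using coherent_exists[OF K I(1), of r n V] by blast
  have e_remove: "coherent V K r e (I - {j})" if "j \<in> I" for j
    using that I by (intro e) auto

  \<comment> \<open>Condition (2) stops at \<open>m\<close> colours; for \<open>R = I\<close> its
    place is taken by \<open>K\<close>, whose homology vanishes in degree
    \<open>m - 1 = card I - 2\<close>.\<close>
  define L where "L R = (if R = I then K else colour_missing V K R)" for R
  have L: "simplicial_complex (L R)" for R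
    using K simplicial_complex_colour_missing[OF K] by (simp add: L_def)
  have L_subset: "L R \<subseteq> K" for R
    by (auto simp: L_def colour_missing_def)
  have L_mono: "L (R - {q}) \<subseteq> L R" if "R \<subseteq> I" for R q
    using that by (auto simp: L_def colour_missing_def)
  have L_triv: "trivial_group (reduced_homology TYPE('f) (int (card R) - 2) (L R))"
    if R: "R \<subseteq> I" "Suc n \<le> card R" for R
  proof (cases "R = I")
    case True
    then show ?thesis
      using assms(4) I(2) by (simp add: L_def)
  next
    case False
    then have "card R < card I"
      using R(1) I(1) by (intro psubset_card_mono) auto
    then show ?thesis
      using assms(8)[folded I_def, OF R(1)] R n I(2) False by (simp add: L_def)
  qed
  define z where "z R = alt R (\<lambda>j. e (I - {j}) (R - {j}))" for R
  have z_chain: "z R \<in> simplicial_chains (int (Suc n) - 2) (L R)" if R: "R \<subseteq> I" "card R = Suc n" for R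
    unfolding z_def
  proof (rule chains_alt)
    fix j assume j: "j \<in> R"
    have "card (R - {j}) + r = card (I - {j})" "card (R - {j}) = n"
      using j R I finite[OF R(1)] by auto
    then have "e (I - {j}) (R - {j}) \<in> simplicial_chains (int (Suc n) - 2) (colour_induced V K (I - {j}))"
      using coherentD(2)[OF e_remove, of j "R - {j}"] j R(1) by auto
    \<comment> \<open>A simplex without colour \<open>j\<close> misses a colour of \<open>R\<close>,
      because \<open>j\<close> is in \<open>R\<close>.\<close>
    moreover have "colour_induced V K (I - {j}) \<subseteq> L R"
    proof -
      have "j \<notin> colours V \<sigma>" if \<sigma>: "\<sigma> \<in> colour_induced V K (I - {j})" for \<sigma>
      proof
        assume "j \<in> colours V \<sigma>"
        then obtain v where v: "v \<in> \<sigma>" "v \<in> V j"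
          by (auto simp: colours_def)
        then obtain i where "i \<in> I - {j}" "v \<in> V i"
          using \<sigma> unfolding colour_induced_def by blast
        then show False
          using col_eq[of i v] col_eq[of j v] v(2) j R(1) by auto
      qed
      then show ?thesis
        using j by (auto simp: L_def colour_missing_def colour_induced_def)
    qed
    ultimately show "e (I - {j}) (R - {j}) \<in> simplicial_chains (int (Suc n) - 2) (L R)"
      by (rule chains_mono)
  qed
  have z_cycle: "boundary (z R) = 0" if "R \<subseteq> I" "card R = Suc n" for R
    unfolding z_def using that I finite e_remove by (intro coherent_remove_cycle) auto
  have z_cocycle: "alt Q (\<lambda>q. z (Q - {q})) = 0" if "Q \<subseteq> I" "card Q = Suc (Suc n)" for Q
    unfolding z_def using that I e_remove by (intro coherent_remove_cocycle) auto
  obtain g where g: "\<And>R. R \<subseteq> I \<Longrightarrow> Suc n \<le> card R \<Longrightarrow> card R \<le> Suc n + r \<Longrightarrow>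
      g R \<in> simplicial_chains (int (card R) - 1) (L R) \<and>
      boundary (g R) = (if card R = Suc n then z R else alt R (\<lambda>q. g (R - {q})))"
    using exists_compatible_fillings[OF I(1) L L_mono L_triv z_chain z_cycle z_cocycle, of r] by blast
  have g_chain: "g R \<in> simplicial_chains (int (card R) - 1) (L R)"
    if "R \<subseteq> I" "Suc n \<le> card R" for R
    using g[OF that] card_mono[OF I(1) that(1)] I(3) by simp

  let ?a = "\<lambda>R. coef col (g R)"
  \<comment> \<open>Off the full set the carriers force this; at \<open>R = I\<close> a nonzero
    coefficient would exhibit a rainbow simplex.\<close>
  have diag: "?a R R = 0" if R: "R \<subseteq> I" "Suc n \<le> card R" for R
  proof (cases "R = I")
    case False
    then have "g R \<in> simplicial_chains (int (card R) - 1) (colour_missing V K R)"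
      using g_chain[OF R] by (simp add: L_def)
    then show ?thesis
      using R(2) by (intro coef_colour_missing[OF col]) auto
  next
    case True
    show ?thesis
    proof (rule ccontr)
      assume nz: "?a R R \<noteq> 0"
      have "\<exists>\<sigma>\<in>Poly_Mapping.keys (g R). inj_on col \<sigma> \<and> col ` \<sigma> = I"
      proof (rule ccontr)
        assume "\<not> ?thesis"
        then have "?a R I = 0"
          by (intro coef_eq_zero) auto
        then show False
          using nz True by simp
      qed
      then obtain \<sigma> where \<sigma>: "\<sigma> \<in> Poly_Mapping.keys (g R)" "inj_on col \<sigma>" "col ` \<sigma> = I"
        by blast
      have "\<sigma> \<noteq> {}"
        using \<sigma>(3) I(2) by auto
      then have "\<sigma> \<in> K"
        using \<sigma>(1) g_chain[OF R] True by (auto simp: L_def simplicial_chains_def faces_def)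
      have "\<exists>!v. v \<in> \<sigma> \<inter> V i" if i: "i \<in> I" for i
      proof -
        obtain v where v: "v \<in> \<sigma>" "col v = i"
          using i \<sigma>(3) by blast
        have "v \<in> V i"
          using properly_coloured_vertex(2)[OF col \<open>\<sigma> \<in> K\<close> v(1)] v(2) by simp
        moreover have "w = v" if "w \<in> \<sigma> \<inter> V i" for w
        proof (rule inj_onD[OF \<sigma>(2)])
          show "col w = col v"
            using that v(2) col_eq[OF i, of w] by simp
        qed (use that v(1) in auto)
        ultimately show ?thesis
          using v(1) by blast
      qed
      then show False
        using no_rainbow \<open>\<sigma> \<in> K\<close> unfolding rainbow_simplex_def I_def by blast
    qed
  qed

  have p: "0 \<in> I"
    by (simp add: I_def)
  have insert_card: "insert 0 W \<subseteq> I" "card (insert 0 W) = Suc l" "0 \<notin> W" "W \<subseteq> I" "card W = l"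
    if "W \<in> subsets (I - {0}) l" for W l
  proof -
    show W: "0 \<notin> W" "W \<subseteq> I" "card W = l"
      using that by (auto simp: subsets_def)
    then show "insert 0 W \<subseteq> I" "card (insert 0 W) = Suc l"
      using p finite[OF W(2)] by auto
  qed
  have sum_zero: "(\<Sum>W\<in>subsets (I - {0}) l. ?a (insert 0 W) (insert 0 W)) = 0" if "n \<le> l" for l
    using that insert_card(1,2) by (intro sum.neutral ballI diag) auto
  \<comment> \<open>The value is \<open>1\<close> at \<open>l = n\<close>. Since all diagonal
    entries vanish, each further step only changes its sign, so it stays nonzero up to
    \<open>l = m\<close>, where the defining sum is empty.\<close>
  have "off_trace I 0 l ?a \<noteq> 0" if "n \<le> l" "l \<le> m" for l
    using that
  proof (induction l rule: dec_induct)
    case base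
    have "(\<Sum>W\<in>subsets (I - {0}) n. ?a (insert 0 W) (insert 0 W)) + off_trace I 0 n ?a =
        trace (I - {0}) n (\<lambda>R. coef col (e (I - {0}) R))"
    proof (rule trace_remove[OF col I(1) order_refl p])
      fix W assume "W \<in> subsets (I - {0}) n"
      note W = insert_card[OF this]
      have "g (insert 0 W) \<in> simplicial_chains (int (card (insert 0 W)) - 1) (L (insert 0 W))"
        using g_chain[OF W(1)] W(2) by simp
      then show "g (insert 0 W) \<in> simplicial_chains (int n) (colour_induced V K I)"
        unfolding W(2) colour_induced_all[OF col]
        by (auto intro: chains_mono[OF _ L_subset])
      show "boundary (g (insert 0 W)) = alt (insert 0 W) (\<lambda>j. e (I - {j}) (insert 0 W - {j}))"
        using g[OF W(1)] W(2) by (simp add: z_def)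
    next
      fix j R assume "j \<in> I" "R \<subseteq> I - {j}" "card R = n"
      then show "e (I - {j}) R \<in> simplicial_chains (int n - 1) (colour_induced V K (I - {j}))"
        using coherentD(2)[OF e_remove, of j R] I by simp
    qed
    also have "\<dots> = 1"
    proof (rule trace_coherent[OF col I(1)])
      show c: "card (I - {0}) = n + r"
        using p I by simp
      fix J assume J: "J \<subseteq> I - {0}" "r \<le> card J"
      then have "card J \<le> n + r"
        using card_mono[of "I - {0}" J] c I(1) by simp
      then show "coherent V K r e J"
        using J by (intro e) auto
    qed auto
    finally show ?case
      by (simp add: sum_zero)
  next
    case (step l)
    have "off_trace I 0 (Suc l) ?a =
        (\<Sum>W\<in>subsets (I - {0}) (Suc l). ?a (insert 0 W) (insert 0 W)) + off_trace I 0 (Suc l) ?a"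
      using step.hyps by (simp add: sum_zero)
    also have "\<dots> = (\<Sum>W\<in>subsets (I - {0}) (Suc l). signed (rank 0 W)
        (\<Sum>t\<in>I - W. signed (rank t W) (?a (insert 0 W) (insert t W))))"
      by (rule sum_signed_coboundary[symmetric, OF I(1) p])
    also have "\<dots> = (\<Sum>W\<in>subsets (I - {0}) (Suc l). signed (rank 0 W)
        (alt (insert 0 W) (\<lambda>q. ?a (insert 0 W - {q}) W)))"
    proof (intro sum.cong refl arg_cong[where f = "signed _"])
      fix W assume "W \<in> subsets (I - {0}) (Suc l)"
      note W = insert_card[OF this]
      have "g (insert 0 W) \<in> simplicial_chains (int (card (insert 0 W)) - 1) K"
        using g_chain[OF W(1)] W(2) step.hyps
        by (auto intro: chains_mono[OF _ L_subset])
      then have "(\<Sum>t\<in>I - W. signed (rank t W) (?a (insert 0 W) (insert t W))) =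
          coef col (boundary (g (insert 0 W))) W"
        by (rule coef_boundary_chain[symmetric, OF col I(1)])
      \<comment> \<open>The set \<open>insert 0 W\<close> has \<open>l + 2\<close> elements, hence
        more than \<open>Suc n\<close>, so its boundary comes from smaller \<open>g\<close> and not
        from \<open>z\<close>.\<close>
      also have "boundary (g (insert 0 W)) = alt (insert 0 W) (\<lambda>q. g (insert 0 W - {q}))"
        using g[OF W(1)] W(2) step.hyps step.prems I by simp
      finally show "(\<Sum>t\<in>I - W. signed (rank t W) (?a (insert 0 W) (insert t W))) =
          alt (insert 0 W) (\<lambda>q. ?a (insert 0 W - {q}) W)"
        by (simp add: coef_alt)
    qed
    also have "\<dots> = trace (I - {0}) (Suc l) ?a - off_trace I 0 l ?a"
      by (rule sum_signed_alt[OF I(1)])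
    also have "trace (I - {0}) (Suc l) ?a = 0"
      unfolding trace_def
      using step.hyps insert_card(4,5) by (intro sum.neutral ballI diag) auto
    finally show ?case
      using step by simp
  qed
  then have "off_trace I 0 m ?a \<noteq> 0"
    using n(2) by simp
  moreover have "off_trace I 0 m ?a = 0"
    unfolding off_trace_def
  proof (rule sum.neutral, rule ballI)
    fix W assume W: "W \<in> subsets (I - {0}) m"
    \<comment> \<open>With \<open>m\<close> elements, \<open>W\<close> exhausts
      \<open>I - {0}\<close>, so no index \<open>t\<close> is left.\<close>
    then have "insert 0 W = I"
      using insert_card[OF W] by (intro card_eq)
    then have "I - {0} - W = {}"
      by auto
    then show "(\<Sum>t\<in>I - {0} - W. signed (rank 0 W + rank t W) (?a (insert 0 W) (insert t W))) = 0"
      by (simp only: sum.empty)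
  qed
  ultimately show False
    by simp
qed

end
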